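(* Let $f,g:\mathbb{R}^n\to\mathbb{R}\cup\{\infty\}$ be closed, proper, convex functions, let $\gamma>0$, $z^0\in\mathbb{R}^n$, and let $x^{k+1/2},x^{k+1},z^{k+1}$ ($k=0,1,\dots$) be the DRS iterates. Suppose $d^\star=p^\star=-\infty$, the primal problem (P) is feasible, and (P) has a primal improving direction. Then the dual problem (D) is strongly infeasible; $x^{k+1}-x^{k+1/2}\to\gamma d$, where $d$ is a primal improving direction; \[ \lim_{k\to\infty}\bigl(f(x^{k+1/2})+g(x^{k+1})\bigr)=-\infty ; \] and the sequence $(x^{k+1/2},x^{k+1})_{k\ge0}$ does not converge. Furthermore, $\mathrm{dist}(x^{k+1/2},\mathrm{dom} g)\to 0$ and $\mathrm{dist}(x^{k+1},\mathrm{dom} f)\to 0$.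
   Context: A convex function is closed if its epigraph is closed, and proper if it is finite somewhere. $\mathrm{dom} f=\{x: f(x)<\infty\}$. $\mathrm{dist}(x,A)=\inf_{a\in A}\|x-a\|$. $f^*(\nu)=\sup_x\{\langle \nu,x\rangle-f(x)\}$ is the convex conjugate. The recession function of a closed proper convex $f$ is $\mathrm{rec} f(d)=\lim_{\alpha\to\infty}\frac{f(x+\alpha d)-f(x)}{\alpha}$ for any $x\in\mathrm{dom} f$ (the value does not depend on $x$). Primal problem (P): minimize $f(x)+g(x)$ over $x\in\mathbb{R}^n$, with optimal value $p^\star=\inf_x\{f(x)+g(x)\}\in[-\infty,\infty]$. It is feasible if $\mathrm{dom} f\cap\mathrm{dom} g\neq\emptyset$. Dual problem (D): maximize $-f^*(\nu)-g^*(-\nu)$ over $\nu\in\mathbb{R}^n$, with optimal value $d^\star=\sup_\nu\{-f^*(\nu)-g^*(-\nu)\}\in[-\infty,\infty]$. (D) is strongly infeasible if $0\notin\overline{\mathrm{dom} f^*+\mathrm{dom} g^*}$. A primal improving direction is a $d\in\mathbb{R}^n$ with $\mathrm{rec} f(d)+\mathrm{rec} g(d)<0$. $\mathrm{Prox}_h(z)=\arg\min_x\{h(x)+\tfrac12\|x-z\|^2\}$. Douglas--Rachford splitting (DRS) with parameter $\gamma>0$ and starting point $z^0\in\mathbb{R}^n$: for $k=0,1,\dots$, $x^{k+1/2}=\mathrm{Prox}_{\gamma f}(z^k)$, $x^{k+1}=\mathrm{Prox}_{\gamma g}(2x^{k+1/2}-z^k)$, $z^{k+1}=z^k+x^{k+1}-x^{k+1/2}$.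 *)

theory Defs
  imports "HOL-Analysis.Analysis" "HOL-Library.Set_Algebras"
begin

text \<open>
  Functions into the extended reals have type \<^typ>\<open>'a \<Rightarrow> ereal\<close>. That the value
  \<open>-\<infinity>\<close> is not attained is part of \<open>closed_proper_convex\<close> below.
\<close>

definition eff_dom :: "('a \<Rightarrow> ereal) \<Rightarrow> 'a set"
  where "eff_dom f = {x. f x < \<infinity>}"

text \<open>The library's \<^const>\<open>epigraph\<close> only covers real-valued functions.\<close>

definition ereal_epigraph :: "('a \<Rightarrow> ereal) \<Rightarrow> ('a \<times> real) set"
  where "ereal_epigraph f = {(x, r). f x \<le> ereal r}"

definition closed_proper_convex :: "('a::euclidean_space \<Rightarrow> ereal) \<Rightarrow> bool"
  where "closed_proper_convex f \<longleftrightarrow>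
    (\<forall>x. f x \<noteq> -\<infinity>) \<and>
    convex (ereal_epigraph f) \<and>
    closed (ereal_epigraph f) \<and>
    (\<exists>x. \<bar>f x\<bar> \<noteq> \<infinity>)"

definition conjugate_fun :: "('a::real_inner \<Rightarrow> ereal) \<Rightarrow> 'a \<Rightarrow> ereal"
  where "conjugate_fun f \<nu> = (SUP x. ereal (\<nu> \<bullet> x) - f x)"

text \<open>
  For closed proper convex \<open>f\<close> the limit exists in the extended reals and is the
  same for every base point, so the description is well defined.
\<close>

definition recession_fun :: "('a::real_vector \<Rightarrow> ereal) \<Rightarrow> 'a \<Rightarrow> ereal"
  where "recession_fun f d = (THE l. \<forall>x\<in>eff_dom f.
    ((\<lambda>\<alpha>. (f (x + \<alpha> *\<^sub>R d) - f x) / ereal \<alpha>) \<longlongrightarrow> l) at_top)"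

definition primal_value :: "('a \<Rightarrow> ereal) \<Rightarrow> ('a \<Rightarrow> ereal) \<Rightarrow> ereal"
  where "primal_value f g = (INF x. f x + g x)"

definition primal_feasible :: "('a \<Rightarrow> ereal) \<Rightarrow> ('a \<Rightarrow> ereal) \<Rightarrow> bool"
  where "primal_feasible f g \<longleftrightarrow> eff_dom f \<inter> eff_dom g \<noteq> {}"

definition dual_value :: "('a::real_inner \<Rightarrow> ereal) \<Rightarrow> ('a \<Rightarrow> ereal) \<Rightarrow> ereal"
  where "dual_value f g = (SUP \<nu>. - conjugate_fun f \<nu> - conjugate_fun g (- \<nu>))"

definition dual_strongly_infeasible :: "('a::real_inner \<Rightarrow> ereal) \<Rightarrow> ('a \<Rightarrow> ereal) \<Rightarrow> bool"
  where "dual_strongly_infeasible f g \<longleftrightarrow>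
    0 \<notin> closure (eff_dom (conjugate_fun f) + eff_dom (conjugate_fun g))"

definition primal_improving_direction ::
    "('a::real_vector \<Rightarrow> ereal) \<Rightarrow> ('a \<Rightarrow> ereal) \<Rightarrow> 'a \<Rightarrow> bool"
  where "primal_improving_direction f g d \<longleftrightarrow> recession_fun f d + recession_fun g d < 0"

text \<open>For closed proper convex \<open>h\<close> the minimiser exists and is unique.\<close>

definition prox :: "('a::real_inner \<Rightarrow> ereal) \<Rightarrow> 'a \<Rightarrow> 'a"
  where "prox h z = arg_min (\<lambda>x. h x + ereal (1 / 2 * (norm (x - z))\<^sup>2)) (\<lambda>_. True)"

text \<open>
  \<open>xh k\<close> stands for the half-step iterate \<open>x\<^bsup>k+1/2\<^esup>\<close>; the value \<open>x 0\<close> plays no role.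
\<close>

definition drs_iterates ::
    "('a::real_inner \<Rightarrow> ereal) \<Rightarrow> ('a \<Rightarrow> ereal) \<Rightarrow> real \<Rightarrow> 'a \<Rightarrow>
     (nat \<Rightarrow> 'a) \<Rightarrow> (nat \<Rightarrow> 'a) \<Rightarrow> (nat \<Rightarrow> 'a) \<Rightarrow> bool"
  where "drs_iterates f g \<gamma> z0 xh x z \<longleftrightarrow>
    z 0 = z0 \<and>
    (\<forall>k. xh k = prox (\<lambda>y. ereal \<gamma> * f y) (z k) \<and>
         x (Suc k) = prox (\<lambda>y. ereal \<gamma> * g y) (2 *\<^sub>R xh k - z k) \<and>
         z (Suc k) = z k + x (Suc k) - xh k)"

end

theory Submission
  imports Defs
begin

text \<open>
  Write \<open>A\<close> and \<open>B\<close> for the effective domains of the conjugates of \<open>f\<close> and \<open>g\<close>. The recession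
  function of \<open>f\<close> is the support function of \<open>A\<close> (\<open>recession_fun_eq_support\<close>), so an improving
  direction is exactly a strict separation of \<open>A + B\<close> from the origin. This is strong
  infeasibility of the dual, and it makes the point \<open>w\<close> of least norm in the closure of \<open>A + B\<close>
  nonzero. By the projection inequality \<open>- w\<close> is itself improving, and it comes with numbers
  \<open>s\<close>, \<open>t\<close> such that \<open>f\<close> grows at rate at most \<open>s\<close> and \<open>g\<close> at rate at most \<open>t\<close> along \<open>- w\<close>, with
  \<open>s + t = - (norm w)\<^sup>2\<close> (\<open>min_norm_direction\<close>).

  The step \<open>\<delta> k = z k - z (Suc k)\<close> of the splitting equals \<open>\<gamma> (u k + v k)\<close> for subgradients
  \<open>u k \<in> A\<close> and \<open>v k \<in> B\<close>; hence no step is shorter than \<open>\<gamma> (norm w)\<close>, and everything rests on showing that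
  the steps converge to the shortest possible one, \<open>\<gamma> w\<close>. Two ingredients give this.

  First, \<open>z k / k\<close> tends to \<open>- \<gamma> w\<close> (\<open>z_rate\<close>). Let \<open>\<phi> k\<close> be the objective
  \<open>f (xh k) + g (x (Suc k))\<close>. The subgradient inequalities bound it from above, against any
  feasible point \<open>p\<close>, by \<open>f p + g p + \<delta> k \<bullet> (z (Suc k) - p) / \<gamma>\<close>. Affine minorants with slopes
  \<open>a \<in> A\<close> and \<open>b \<in> B\<close>, where \<open>a + b\<close> is close to \<open>w\<close>, bound it from below by \<open>w \<bullet> z (Suc k)\<close> up to an
  error \<open>o(k)\<close>. With the feasible points \<open>p - k \<gamma> w\<close>, whose objective value decreases at rate at least
  \<open>\<gamma> (norm w)\<^sup>2\<close>, the two bounds combine to a Fejer-type recurrence for the squared distance of \<open>z k\<close> to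
  \<open>p - k \<gamma> w\<close>, with increments \<open>o(k)\<close>; so this distance is \<open>o(k)\<close>.

  Second, for an orbit of a firmly nonexpansive map the norms of the steps decrease to a limit
  that does not exceed the norm of the average displacement
  (\<open>firmly_nonexpansive_orbit_step_norm\<close>). Here the latter is \<open>\<gamma> (norm w)\<close>, and together with
  \<open>\<gamma> (norm w)\<^sup>2 \<le> \<delta> k \<bullet> w\<close> this forces \<open>\<delta> k\<close> to tend to \<open>\<gamma> w\<close>.

  The remaining claims follow. The upper bound on \<open>\<phi>\<close> with fixed \<open>p\<close> behaves like
  \<open>- k \<gamma> (norm w)\<^sup>2\<close>, so \<open>\<phi>\<close> tends to \<open>-\<infinity>\<close>; if the iterates converged, affine minorants would keep it
  bounded below. The domain of \<open>f\<close> is mapped into itself by translation by \<open>- \<gamma> w\<close>, so \<open>x (Suc k) = xh k - \<delta> k\<close> is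
  close to it. Finally \<open>xh (Suc k) - x (Suc k) = \<gamma> (u (Suc k) - u k)\<close>, and the differences
  of consecutive subgradients vanish: \<open>u k \<bullet> w\<close> converges because \<open>u k \<bullet> w\<close> and \<open>v k \<bullet> w\<close> are
  bounded below by numbers whose sum is the limit of their sum, and monotonicity of the
  subdifferential does the rest.
\<close>

section \<open>Closed proper convex functions and their conjugates\<close>

abbreviation rval :: "('a \<Rightarrow> ereal) \<Rightarrow> 'a \<Rightarrow> real"
  where "rval f x \<equiv> real_of_ereal (f x)"

lemma eff_domE:
  assumes "closed_proper_convex f" "x \<in> eff_dom f"
  obtains r where "f x = ereal r"
  using assms by (cases "f x") (auto simp: closed_proper_convex_def eff_dom_def)

lemma ereal_epigraph_eq_epigraph:
  assumes "closed_proper_convex f"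
  shows "ereal_epigraph f = epigraph (eff_dom f) (rval f)"
proof -
  have "f x \<le> ereal r \<longleftrightarrow> x \<in> eff_dom f \<and> rval f x \<le> r" for x r
    using assms by (cases "f x") (auto simp: closed_proper_convex_def eff_dom_def)
  then show ?thesis
    by (auto simp: ereal_epigraph_def epigraph_def)
qed

lemma convex_on_rval:
  assumes "closed_proper_convex f"
  shows "convex_on (eff_dom f) (rval f)"
  using assms ereal_epigraph_eq_epigraph[OF assms]
  by (simp add: convex_epigraph[symmetric] closed_proper_convex_def)

lemma closed_epigraph_rval:
  assumes "closed_proper_convex f"
  shows "closed (epigraph (eff_dom f) (rval f))"
  using assms ereal_epigraph_eq_epigraph[OF assms]
  by (simp add: closed_proper_convex_def)

lemma eff_dom_nonempty:
  assumes "closed_proper_convex f"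
  obtains x where "x \<in> eff_dom f"
proof -
  from assms obtain x where "\<bar>f x\<bar> \<noteq> \<infinity>" by (metis closed_proper_convex_def)
  then have "x \<in> eff_dom f" by (cases "f x") (auto simp: eff_dom_def)
  then show ?thesis by (rule that)
qed

text \<open>
  Elements of the domain of the conjugate are used throughout as slopes of affine minorants;
  this form stays within the real numbers.
\<close>

lemma mem_eff_dom_conjugate_iff:
  assumes f: "closed_proper_convex f"
  shows "a \<in> eff_dom (conjugate_fun f) \<longleftrightarrow> (\<exists>c. \<forall>x\<in>eff_dom f. a \<bullet> x - c \<le> rval f x)"
proof
  assume "a \<in> eff_dom (conjugate_fun f)"
  then have fin: "conjugate_fun f a < \<infinity>" by (simp add: eff_dom_def)
  have le: "ereal (a \<bullet> x - rval f x) \<le> conjugate_fun f a" if "x \<in> eff_dom f" for x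
  proof -
    obtain r where "f x = ereal r" using eff_domE[OF f \<open>x \<in> eff_dom f\<close>] .
    then show ?thesis
      unfolding conjugate_fun_def by (intro SUP_upper2[of x]) auto
  qed
  obtain x0 where "x0 \<in> eff_dom f" using eff_dom_nonempty[OF f] .
  from le[OF this] fin obtain c where "conjugate_fun f a = ereal c"
    by (cases "conjugate_fun f a") auto
  with le have "\<forall>x\<in>eff_dom f. a \<bullet> x - c \<le> rval f x" by fastforce
  then show "\<exists>c. \<forall>x\<in>eff_dom f. a \<bullet> x - c \<le> rval f x" ..
next
  assume "\<exists>c. \<forall>x\<in>eff_dom f. a \<bullet> x - c \<le> rval f x"
  then obtain c where c: "\<And>x. x \<in> eff_dom f \<Longrightarrow> a \<bullet> x - c \<le> rval f x" by blast
  have "ereal (a \<bullet> x) - f x \<le> ereal c" for x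
  proof (cases "x \<in> eff_dom f")
    case True
    obtain r where "f x = ereal r" using eff_domE[OF f True] .
    then show ?thesis using c[OF True] by simp
  next
    case False
    then show ?thesis by (simp add: eff_dom_def)
  qed
  then have "conjugate_fun f a \<le> ereal c"
    unfolding conjugate_fun_def by (intro SUP_least)
  then show "a \<in> eff_dom (conjugate_fun f)"
    by (auto simp: eff_dom_def)
qed

text \<open>
  The epigraph is closed and convex and misses a point strictly below the graph; a hyperplane
  that separates them cannot be vertical, since the epigraph contains the point of the graph
  straight above; it is thus the graph of an affine minorant.
\<close>

lemma eff_dom_conjugate_nonempty:
  assumes f: "closed_proper_convex f"
  obtains a where "a \<in> eff_dom (conjugate_fun f)"
proof -
  obtain x0 where x0: "x0 \<in> eff_dom f" using eff_dom_nonempty[OF f] .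
  have "(x0, rval f x0 - 1) \<notin> epigraph (eff_dom f) (rval f)"
    by (simp add: epigraph_def)
  then obtain n b where nb: "n \<bullet> (x0, rval f x0 - 1) < b"
      "\<And>p. p \<in> epigraph (eff_dom f) (rval f) \<Longrightarrow> b < n \<bullet> p"
    using separating_hyperplane_closed_point[of "epigraph (eff_dom f) (rval f)"]
      convex_on_rval[OF f] closed_epigraph_rval[OF f]
    unfolding convex_epigraph by blast
  obtain v t where n: "n = (v, t)" by (cases n)
  have below: "b < v \<bullet> x + t * rval f x" if "x \<in> eff_dom f" for x
    using nb(2)[of "(x, rval f x)"] that by (simp add: n epigraph_def)
  \<comment> \<open>The two points have the same first component, so the strict inequalities are about \<open>t\<close>.\<close>
  have "t > 0"
    using nb(1) below[OF x0] by (simp add: n algebra_simps)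
  have "(- v /\<^sub>R t) \<bullet> x - (- b / t) \<le> rval f x" if "x \<in> eff_dom f" for x
  proof -
    have "(b - v \<bullet> x) / t \<le> rval f x"
      using below[OF that] \<open>t > 0\<close> by (simp add: pos_divide_le_eq mult.commute)
    then show ?thesis by (simp add: divide_inverse algebra_simps)
  qed
  then have "(- v /\<^sub>R t) \<in> eff_dom (conjugate_fun f)"
    unfolding mem_eff_dom_conjugate_iff[OF f] by blast
  then show ?thesis by (rule that)
qed

lemma convex_eff_dom_conjugate:
  assumes f: "closed_proper_convex f"
  shows "convex (eff_dom (conjugate_fun f))"
proof (rule convexI)
  fix a b :: 'a and s t :: real
  assume ab: "a \<in> eff_dom (conjugate_fun f)" "b \<in> eff_dom (conjugate_fun f)"
    and st: "0 \<le> s" "0 \<le> t" "s + t = 1"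
  obtain c d where cd: "\<And>x. x \<in> eff_dom f \<Longrightarrow> a \<bullet> x - c \<le> rval f x"
      "\<And>x. x \<in> eff_dom f \<Longrightarrow> b \<bullet> x - d \<le> rval f x"
    using ab unfolding mem_eff_dom_conjugate_iff[OF f] by blast
  have "(s *\<^sub>R a + t *\<^sub>R b) \<bullet> x - (s * c + t * d) \<le> rval f x" if "x \<in> eff_dom f" for x
  proof -
    have "s * (a \<bullet> x - c) + t * (b \<bullet> x - d) \<le> s * rval f x + t * rval f x"
      using st by (intro add_mono mult_left_mono cd that)
    also have "\<dots> = rval f x" using st(3) by (metis distrib_right mult_1)
    finally show ?thesis by (simp add: inner_add_left algebra_simps)
  qed
  then show "s *\<^sub>R a + t *\<^sub>R b \<in> eff_dom (conjugate_fun f)"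
    unfolding mem_eff_dom_conjugate_iff[OF f] by blast
qed

lemma subgradient_mem_eff_dom_conjugate:
  assumes f: "closed_proper_convex f"
    and "\<And>y. y \<in> eff_dom f \<Longrightarrow> rval f x + u \<bullet> (y - x) \<le> rval f y"
  shows "u \<in> eff_dom (conjugate_fun f)"
  unfolding mem_eff_dom_conjugate_iff[OF f]
  by (rule exI[of _ "u \<bullet> x - rval f x"]) (use assms(2) in \<open>simp add: inner_diff_right algebra_simps\<close>)

section \<open>Proximal points\<close>

text \<open>
  A convex function is only lower semicontinuous, so the minimum is taken over a slice of the closed
  epigraph, where the objective, linear in the second component, is continuous. An affine
  minorant makes the slice bounded.
\<close>

lemma prox_objective_attains_min:
  assumes f: "closed_proper_convex f" and "\<gamma> > 0"
  obtains x where "x \<in> eff_dom f"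
    "\<And>y. y \<in> eff_dom f \<Longrightarrow> \<gamma> * rval f x + 1/2 * (norm (x - z))\<^sup>2 \<le> \<gamma> * rval f y + 1/2 * (norm (y - z))\<^sup>2"
proof -
  obtain x0 where x0: "x0 \<in> eff_dom f" using eff_dom_nonempty[OF f] .
  obtain a where "a \<in> eff_dom (conjugate_fun f)" using eff_dom_conjugate_nonempty[OF f] .
  then obtain c where c: "\<And>x. x \<in> eff_dom f \<Longrightarrow> a \<bullet> x - c \<le> rval f x"
    unfolding mem_eff_dom_conjugate_iff[OF f] by blast
  define h where "h = (\<lambda>p. \<gamma> * snd p + 1/2 * (norm (fst p - z))\<^sup>2)"
  define M where "M = h (x0, rval f x0)"
  define K where "K = epigraph (eff_dom f) (rval f) \<inter> {p. h p \<le> M}"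
  define R where "R = sqrt (2 * (M - \<gamma> * (a \<bullet> z) + \<gamma> * c) + \<gamma>\<^sup>2 * (norm a)\<^sup>2)"
  have cont: "continuous_on S h" for S
    unfolding h_def by (intro continuous_intros)
  have "closed K"
    unfolding K_def by (intro closed_Int closed_epigraph_rval[OF f] closed_Collect_le cont continuous_intros)
  moreover have "bounded K"
  proof (rule bounded_subset)
    \<comment> \<open>Completing the square in the affine lower bound gives the centre and the radius.\<close>
    show "K \<subseteq> cball (z - \<gamma> *\<^sub>R a) R \<times> {- norm a * (norm (z - \<gamma> *\<^sub>R a) + R) - c .. M / \<gamma>}"
    proof
      fix p assume "p \<in> K"
      then obtain y r where p: "p = (y, r)" and y: "y \<in> eff_dom f" "rval f y \<le> r"
        and hM: "\<gamma> * r + 1/2 * (norm (y - z))\<^sup>2 \<le> M"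
        by (cases p) (auto simp: K_def epigraph_def h_def)
      have ry: "a \<bullet> y - c \<le> r" using c[OF y(1)] y(2) by simp
      then have "\<gamma> * (a \<bullet> y - c) \<le> \<gamma> * r" using \<open>\<gamma> > 0\<close> by simp
      then have "(norm (y - z))\<^sup>2 + 2 * \<gamma> * (a \<bullet> (y - z)) \<le> 2 * (M - \<gamma> * (a \<bullet> z) + \<gamma> * c)"
        using hM by (simp add: inner_diff_right algebra_simps)
      moreover have "(norm (y - (z - \<gamma> *\<^sub>R a)))\<^sup>2 = (norm (y - z))\<^sup>2 + 2 * \<gamma> * (a \<bullet> (y - z)) + \<gamma>\<^sup>2 * (norm a)\<^sup>2"
        unfolding power2_norm_eq_inner
        by (simp add: inner_diff_left inner_diff_right inner_commute power2_eq_square algebra_simps)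
      ultimately have "(norm (y - (z - \<gamma> *\<^sub>R a)))\<^sup>2 \<le> 2 * (M - \<gamma> * (a \<bullet> z) + \<gamma> * c) + \<gamma>\<^sup>2 * (norm a)\<^sup>2"
        by simp
      then have yR: "norm (y - (z - \<gamma> *\<^sub>R a)) \<le> R"
        unfolding R_def by (rule real_le_rsqrt)
      then have "norm y \<le> norm (z - \<gamma> *\<^sub>R a) + R"
        using norm_triangle_sub[of y "z - \<gamma> *\<^sub>R a"] by simp
      then have "norm a * norm y \<le> norm a * (norm (z - \<gamma> *\<^sub>R a) + R)"
        by (simp add: mult_left_mono)
      moreover have "- (norm a * norm y) \<le> a \<bullet> y"
        using Cauchy_Schwarz_ineq2[of a y] by linarith
      ultimately have "- norm a * (norm (z - \<gamma> *\<^sub>R a) + R) - c \<le> r"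
        using ry by simp
      moreover have "\<gamma> * r \<le> M" using hM zero_le_power2[of "norm (y - z)"] by linarith
      then have "r \<le> M / \<gamma>" using \<open>\<gamma> > 0\<close> by (simp add: field_simps)
      ultimately show "p \<in> cball (z - \<gamma> *\<^sub>R a) R \<times> {- norm a * (norm (z - \<gamma> *\<^sub>R a) + R) - c .. M / \<gamma>}"
        using yR by (simp add: p dist_norm norm_minus_commute)
    qed
  qed (intro bounded_Times bounded_cball bounded_closed_interval)
  ultimately have "compact K" by (simp add: compact_eq_bounded_closed)
  moreover have "(x0, rval f x0) \<in> K" using x0 by (simp add: K_def M_def epigraph_def)
  ultimately obtain p where pK: "p \<in> K" and pmin: "\<And>q. q \<in> K \<Longrightarrow> h p \<le> h q"
    using continuous_attains_inf[of K h] cont by blast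
  obtain x r where p: "p = (x, r)" by (cases p)
  have x: "x \<in> eff_dom f" "rval f x \<le> r" "h p \<le> M"
    using pK by (auto simp: K_def p epigraph_def)
  have "\<gamma> * rval f x + 1/2 * (norm (x - z))\<^sup>2 \<le> \<gamma> * rval f y + 1/2 * (norm (y - z))\<^sup>2"
    if y: "y \<in> eff_dom f" for y
  proof -
    have "h p \<le> h (y, rval f y)"
    proof (cases "h (y, rval f y) \<le> M")
      case True
      then show ?thesis using y by (intro pmin) (simp add: K_def epigraph_def)
    qed (use x in auto)
    moreover have "\<gamma> * rval f x \<le> \<gamma> * r" using x \<open>\<gamma> > 0\<close> by simp
    ultimately show ?thesis by (simp add: h_def p)
  qed
  with x(1) show ?thesis by (rule that)
qed

text \<open>
  The proximal point is chosen among the minimisers, so its properties are available once a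
  minimiser is known to exist; off the domain of the function the objective is infinite.
\<close>

lemma prox_mem_minimal:
  assumes f: "closed_proper_convex f" and g: "\<gamma> > 0"
    and x: "x = prox (\<lambda>y. ereal \<gamma> * f y) z"
  shows "x \<in> eff_dom f"
    and "\<And>y. y \<in> eff_dom f \<Longrightarrow> \<gamma> * rval f x + 1/2 * (norm (x - z))\<^sup>2 \<le> \<gamma> * rval f y + 1/2 * (norm (y - z))\<^sup>2"
proof -
  define h where "h = (\<lambda>y. ereal \<gamma> * f y + ereal (1/2 * (norm (y - z))\<^sup>2))"
  have h_eq: "h y = ereal (\<gamma> * rval f y + 1/2 * (norm (y - z))\<^sup>2)" if "y \<in> eff_dom f" for y
  proof -
    obtain r where "f y = ereal r" using eff_domE[OF f \<open>y \<in> eff_dom f\<close>] .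
    then show ?thesis by (simp add: h_def)
  qed
  have h_top: "h y = \<infinity>" if "y \<notin> eff_dom f" for y
    using that g by (simp add: h_def eff_dom_def)
  obtain x' where x': "x' \<in> eff_dom f"
    "\<And>y. y \<in> eff_dom f \<Longrightarrow> \<gamma> * rval f x' + 1/2 * (norm (x' - z))\<^sup>2 \<le> \<gamma> * rval f y + 1/2 * (norm (y - z))\<^sup>2"
    using prox_objective_attains_min[OF f g, of z] by metis
  have "h x' \<le> h y" for y
    using x' h_eq h_top by (cases "y \<in> eff_dom f") auto
  then have "is_arg_min h (\<lambda>_. True) x'" by (simp add: is_arg_min_def not_less)
  then have "is_arg_min h (\<lambda>_. True) x"
    unfolding x prox_def arg_min_def h_def by (rule someI)
  then have xmin: "h x \<le> h y" for y by (auto simp: is_arg_min_def not_less)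
  show xdom: "x \<in> eff_dom f"
    using xmin[of x'] h_eq[OF x'(1)] h_top[of x] by (cases "x \<in> eff_dom f") auto
  show "\<gamma> * rval f x + 1/2 * (norm (x - z))\<^sup>2 \<le> \<gamma> * rval f y + 1/2 * (norm (y - z))\<^sup>2"
    if "y \<in> eff_dom f" for y
    using xmin[of y] by (simp add: h_eq[OF that] h_eq[OF xdom])
qed

text \<open>
  Optimality of \<open>x\<close> against the points of the segment from \<open>x\<close> to \<open>y\<close>: the quadratic term is differentiable
  along it, and convexity bounds the increment of \<open>f\<close> by a multiple of \<open>rval f y - rval f x\<close>.
\<close>

lemma prox_subgradient:
  assumes f: "closed_proper_convex f" and g: "\<gamma> > 0"
    and x: "x = prox (\<lambda>y. ereal \<gamma> * f y) z" and y: "y \<in> eff_dom f"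
  shows "rval f x + ((z - x) /\<^sub>R \<gamma>) \<bullet> (y - x) \<le> rval f y"
proof -
  note xdom = prox_mem_minimal(1)[OF f g x] and xmin = prox_mem_minimal(2)[OF f g x]
  define D where "D = (z - x) \<bullet> (y - x) - \<gamma> * (rval f y - rval f x)"
  have step: "D \<le> t / 2 * (norm (y - x))\<^sup>2" if t: "0 < t" "t \<le> 1" for t
  proof -
    let ?y = "(1 - t) *\<^sub>R x + t *\<^sub>R y"
    have "?y \<in> eff_dom f"
      using convex_on_rval[OF f] xdom y t by (simp add: convex_on_def convex_alt)
    from xmin[OF this] have "\<gamma> * rval f x + 1/2 * (norm (x - z))\<^sup>2 \<le> \<gamma> * rval f ?y + 1/2 * (norm (?y - z))\<^sup>2" .
    moreover have "\<gamma> * rval f ?y \<le> \<gamma> * ((1 - t) * rval f x + t * rval f y)"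
      using convex_onD[OF convex_on_rval[OF f] _ _ xdom y] t g by simp
    moreover have "(norm (?y - z))\<^sup>2 = (norm (x - z))\<^sup>2 - 2 * t * ((z - x) \<bullet> (y - x)) + t\<^sup>2 * (norm (y - x))\<^sup>2"
      unfolding power2_norm_eq_inner
      by (simp add: inner_diff_left inner_diff_right inner_add_left inner_add_right inner_commute power2_eq_square algebra_simps)
    ultimately have "t * D \<le> t * (t / 2 * (norm (y - x))\<^sup>2)"
      by (simp add: D_def algebra_simps power2_eq_square)
    then show ?thesis using t by simp
  qed
  have "((\<lambda>t. t / 2 * (norm (y - x))\<^sup>2) \<longlongrightarrow> 0 / 2 * (norm (y - x))\<^sup>2) (at_right 0)"
    by (intro tendsto_intros) simp
  moreover have "eventually (\<lambda>t. D \<le> t / 2 * (norm (y - x))\<^sup>2) (at_right 0)"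
    using eventually_at_right_real[OF zero_less_one]
    by (rule eventually_mono) (use step in auto)
  ultimately have "D \<le> 0"
    using tendsto_lowerbound[of "\<lambda>t. t / 2 * (norm (y - x))\<^sup>2" _ "at_right 0" D] by simp
  then have "(z - x) \<bullet> (y - x) / \<gamma> \<le> rval f y - rval f x"
    using g by (simp add: D_def field_simps)
  then show ?thesis using g by (simp add: divide_inverse mult.commute)
qed

section \<open>Recession functions as support functions\<close>

text \<open>
  This is the half of the duality between recession and support functions that needs closedness.
  Instead of the biconjugate theorem, the proof uses the proximal points \<open>p n\<close> of \<open>y = x + \<alpha> d\<close> for
  parameters \<open>l n\<close> tending to \<open>0\<close>: the residuals \<open>u = (y - p n) / l n\<close> are subgradients, so the hypothesis
  applies to them, and the subgradient inequality at \<open>x\<close> bounds the values at \<open>p n\<close> by the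
  claimed bound. Since \<open>p n\<close> tends to \<open>y\<close>, the closed epigraph transfers this to \<open>y\<close>.
\<close>

lemma rval_add_le_of_conjugate_dom_bound:
  assumes f: "closed_proper_convex f" and x: "x \<in> eff_dom f" and "0 \<le> \<alpha>"
    and s: "\<And>a. a \<in> eff_dom (conjugate_fun f) \<Longrightarrow> a \<bullet> d \<le> s"
  shows "x + \<alpha> *\<^sub>R d \<in> eff_dom f" "rval f (x + \<alpha> *\<^sub>R d) \<le> rval f x + \<alpha> * s"
proof -
  define y where "y = x + \<alpha> *\<^sub>R d"
  define r where "r = rval f x + \<alpha> * s"
  define l where "l n = inverse (real (Suc n))" for n
  define p where "p n = prox (\<lambda>y. ereal (l n) * f y) y" for n
  have l: "l n > 0" for n by (simp add: l_def)
  have p_dom: "p n \<in> eff_dom f" for n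
    using prox_mem_minimal(1)[OF f l] by (simp add: p_def)
  have key: "rval f (p n) + (norm (y - p n))\<^sup>2 / l n \<le> r" for n
  proof -
    define u where "u = (y - p n) /\<^sub>R l n"
    have sub: "rval f (p n) + u \<bullet> (v - p n) \<le> rval f v" if "v \<in> eff_dom f" for v
      unfolding u_def using prox_subgradient[OF f l _ that] by (simp add: p_def)
    then have "u \<in> eff_dom (conjugate_fun f)"
      by (rule subgradient_mem_eff_dom_conjugate[OF f])
    then have "\<alpha> * (u \<bullet> d) \<le> \<alpha> * s"
      using s \<open>0 \<le> \<alpha>\<close> by (simp add: mult_left_mono)
    moreover have "u \<bullet> (x - p n) = (norm (y - p n))\<^sup>2 / l n - \<alpha> * (u \<bullet> d)"
    proof -
      have "x - p n = (y - p n) - \<alpha> *\<^sub>R d" by (simp add: y_def)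
      moreover have "u \<bullet> (y - p n) = (norm (y - p n))\<^sup>2 / l n"
        by (simp add: u_def power2_norm_eq_inner divide_inverse)
      ultimately show ?thesis by (simp add: inner_diff_right)
    qed
    ultimately show ?thesis using sub[OF x] by (simp add: r_def)
  qed
  obtain a where "a \<in> eff_dom (conjugate_fun f)" using eff_dom_conjugate_nonempty[OF f] .
  then obtain c where c: "\<And>x. x \<in> eff_dom f \<Longrightarrow> a \<bullet> x - c \<le> rval f x"
    unfolding mem_eff_dom_conjugate_iff[OF f] by blast
  have bound: "(norm (y - p n))\<^sup>2 \<le> 2 * l n * (r - a \<bullet> y + c) + (l n)\<^sup>2 * (norm a)\<^sup>2" for n
  proof -
    let ?e = "norm (y - p n)"
    have "?e\<^sup>2 / l n \<le> r - a \<bullet> y + c + a \<bullet> (y - p n)"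
      using key[of n] c[OF p_dom[of n]] by (simp add: inner_diff_right)
    also have "\<dots> \<le> r - a \<bullet> y + c + norm a * ?e"
      using norm_cauchy_schwarz[of a "y - p n"] by simp
    finally have "?e\<^sup>2 \<le> (r - a \<bullet> y + c + norm a * ?e) * l n"
      using l[of n] by (simp only: pos_divide_le_eq)
    moreover have "0 \<le> (?e - l n * norm a)\<^sup>2" by simp
    ultimately show ?thesis by (simp add: power2_eq_square algebra_simps)
  qed
  have l0: "l \<longlonglongrightarrow> 0" unfolding l_def by (rule LIMSEQ_inverse_real_of_nat)
  have "(\<lambda>n. 2 * l n * (r - a \<bullet> y + c) + (l n)\<^sup>2 * (norm a)\<^sup>2) \<longlonglongrightarrow> 2 * 0 * (r - a \<bullet> y + c) + 0\<^sup>2 * (norm a)\<^sup>2"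
    by (intro tendsto_intros l0)
  then have "(\<lambda>n. 2 * l n * (r - a \<bullet> y + c) + (l n)\<^sup>2 * (norm a)\<^sup>2) \<longlonglongrightarrow> 0"
    by simp
  then have "(\<lambda>n. (norm (y - p n))\<^sup>2) \<longlonglongrightarrow> 0"
    by (rule Lim_null_comparison[rotated]) (rule always_eventually, use bound in simp)
  then have "(\<lambda>n. norm (y - p n)) \<longlonglongrightarrow> 0"
    using tendsto_real_sqrt[of "\<lambda>n. (norm (y - p n))\<^sup>2" 0] by simp
  then have "p \<longlonglongrightarrow> y"
    using tendsto_diff[OF tendsto_const tendsto_norm_zero_cancel, of "\<lambda>n. y - p n" sequentially y] by simp
  then have lim: "(\<lambda>n. (p n, r)) \<longlonglongrightarrow> (y, r)" by (intro tendsto_intros)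
  have "(p n, r) \<in> epigraph (eff_dom f) (rval f)" for n
  proof -
    have "0 \<le> (norm (y - p n))\<^sup>2 / l n" using l[of n] by simp
    with key[of n] p_dom[of n] show ?thesis by (simp add: epigraph_def)
  qed
  then have "(y, r) \<in> epigraph (eff_dom f) (rval f)"
    by (rule closed_sequentially[OF closed_epigraph_rval[OF f] _ lim])
  then show "x + \<alpha> *\<^sub>R d \<in> eff_dom f" "rval f (x + \<alpha> *\<^sub>R d) \<le> rval f x + \<alpha> * s"
    by (auto simp: epigraph_def y_def r_def)
qed

text \<open>
  From below, each affine minorant with slope \<open>a\<close> contributes \<open>a \<bullet> d\<close> in the limit, its offset being
  divided by \<open>\<alpha>\<close>; from above, the quotient never exceeds the supremum.
\<close>

lemma recession_quotient_tendsto: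
  assumes f: "closed_proper_convex f" and x: "x \<in> eff_dom f"
  shows "((\<lambda>\<alpha>. (f (x + \<alpha> *\<^sub>R d) - f x) / ereal \<alpha>) \<longlongrightarrow> (SUP a\<in>eff_dom (conjugate_fun f). ereal (a \<bullet> d))) at_top"
    (is "(?q \<longlongrightarrow> ?S) at_top")
proof (rule order_tendstoI)
  obtain fx where fx: "f x = ereal fx" using eff_domE[OF f x] .
  fix l :: ereal assume "l < ?S"
  then obtain a where a: "a \<in> eff_dom (conjugate_fun f)" "l < ereal (a \<bullet> d)"
    by (auto simp: less_SUP_iff)
  obtain c where c: "\<And>x. x \<in> eff_dom f \<Longrightarrow> a \<bullet> x - c \<le> rval f x"
    using a(1) unfolding mem_eff_dom_conjugate_iff[OF f] by blast
  let ?m = "\<lambda>\<alpha>. a \<bullet> d - (c + fx - a \<bullet> x) * inverse \<alpha>"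
  have ge: "ereal (?m \<alpha>) \<le> ?q \<alpha>" if "\<alpha> > 0" for \<alpha> :: real
  proof (cases "x + \<alpha> *\<^sub>R d \<in> eff_dom f")
    case True
    obtain r where r: "f (x + \<alpha> *\<^sub>R d) = ereal r" using eff_domE[OF f True] .
    have "a \<bullet> x + \<alpha> * (a \<bullet> d) - c \<le> r"
      using c[OF True] by (simp add: r inner_add_right)
    then have "(a \<bullet> x + \<alpha> * (a \<bullet> d) - c - fx) / \<alpha> \<le> (r - fx) / \<alpha>"
      using that by (intro divide_right_mono) auto
    moreover have "(a \<bullet> x + \<alpha> * (a \<bullet> d) - c - fx) / \<alpha> = a \<bullet> d - (c + fx - a \<bullet> x) * inverse \<alpha>"
      using that by (simp add: field_simps)
    ultimately have "a \<bullet> d - (c + fx - a \<bullet> x) * inverse \<alpha> \<le> (r - fx) / \<alpha>"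
      by simp
    then show ?thesis using that by (simp add: r fx)
  next
    case False
    then show ?thesis using that by (simp add: eff_dom_def fx)
  qed
  have "(?m \<longlongrightarrow> a \<bullet> d - (c + fx - a \<bullet> x) * 0) at_top"
    by (intro tendsto_intros tendsto_inverse_0_at_top filterlim_ident)
  then have "((\<lambda>\<alpha>. ereal (?m \<alpha>)) \<longlongrightarrow> ereal (a \<bullet> d)) at_top" by simp
  from order_tendstoD(1)[OF this a(2)] eventually_gt_at_top[of 0]
  show "\<forall>\<^sub>F \<alpha> in at_top. l < ?q \<alpha>"
    by eventually_elim (use ge less_le_trans in blast)
next
  obtain fx where fx: "f x = ereal fx" using eff_domE[OF f x] .
  fix u :: ereal assume u: "?S < u"
  obtain a0 where a0: "a0 \<in> eff_dom (conjugate_fun f)" using eff_dom_conjugate_nonempty[OF f] .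
  have "ereal (a0 \<bullet> d) \<le> ?S" using a0 by (rule SUP_upper)
  with u obtain s where s: "?S = ereal s" by (cases ?S) auto
  have "a \<bullet> d \<le> s" if "a \<in> eff_dom (conjugate_fun f)" for a
    using SUP_upper[OF that, of "\<lambda>a. ereal (a \<bullet> d)"] by (simp add: s)
  note rb = rval_add_le_of_conjugate_dom_bound[OF f x _ this]
  have "?q \<alpha> \<le> ereal s" if "0 < \<alpha>" for \<alpha> :: real
  proof -
    obtain r where r: "f (x + \<alpha> *\<^sub>R d) = ereal r" using eff_domE[OF f rb(1)[OF less_imp_le[OF \<open>0 < \<alpha>\<close>]]] .
    have "r \<le> fx + \<alpha> * s" using rb(2)[of \<alpha>] that by (simp add: r fx)
    then show ?thesis using that by (simp add: r fx field_simps)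
  qed
  with u show "\<forall>\<^sub>F \<alpha> in at_top. ?q \<alpha> < u"
    unfolding s using eventually_gt_at_top[of "0::real"]
    by (elim eventually_mono) (metis le_less_trans)
qed

text \<open>
  The support function of the domain of the conjugate is the limit from every base point, so it
  is the value that the definite description picks.
\<close>

lemma recession_fun_eq_support:
  assumes f: "closed_proper_convex f"
  shows "recession_fun f d = (SUP a\<in>eff_dom (conjugate_fun f). ereal (a \<bullet> d))"
  unfolding recession_fun_def
proof (rule the_equality)
  show "\<forall>x\<in>eff_dom f. ((\<lambda>\<alpha>. (f (x + \<alpha> *\<^sub>R d) - f x) / ereal \<alpha>) \<longlongrightarrow> (SUP a\<in>eff_dom (conjugate_fun f). ereal (a \<bullet> d))) at_top"
    using recession_quotient_tendsto[OF f] by blast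
next
  fix l assume l: "\<forall>x\<in>eff_dom f. ((\<lambda>\<alpha>. (f (x + \<alpha> *\<^sub>R d) - f x) / ereal \<alpha>) \<longlongrightarrow> l) at_top"
  obtain x where x: "x \<in> eff_dom f" using eff_dom_nonempty[OF f] .
  show "l = (SUP a\<in>eff_dom (conjugate_fun f). ereal (a \<bullet> d))"
    by (rule tendsto_unique[OF _ bspec[OF l x] recession_quotient_tendsto[OF f x]]) simp
qed

section \<open>Improving directions and the least-norm dual residual\<close>

lemma primal_improving_directionI:
  assumes f: "closed_proper_convex f" and g: "closed_proper_convex g"
    and "\<And>a. a \<in> eff_dom (conjugate_fun f) \<Longrightarrow> a \<bullet> d \<le> s"
    and "\<And>b. b \<in> eff_dom (conjugate_fun g) \<Longrightarrow> b \<bullet> d \<le> t"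
    and "s + t < 0"
  shows "primal_improving_direction f g d"
proof -
  have "recession_fun f d \<le> ereal s" "recession_fun g d \<le> ereal t"
    using assms(3,4) by (auto simp: recession_fun_eq_support f g intro!: SUP_least)
  then have "recession_fun f d + recession_fun g d \<le> ereal s + ereal t"
    by (rule add_mono)
  also have "\<dots> < 0" using \<open>s + t < 0\<close> by simp
  finally show ?thesis by (simp add: primal_improving_direction_def)
qed

lemma primal_improving_directionE:
  assumes f: "closed_proper_convex f" and g: "closed_proper_convex g"
    and d: "primal_improving_direction f g d"
  obtains s t where "\<And>a. a \<in> eff_dom (conjugate_fun f) \<Longrightarrow> a \<bullet> d \<le> s"
    "\<And>b. b \<in> eff_dom (conjugate_fun g) \<Longrightarrow> b \<bullet> d \<le> t" "s + t < 0"
proof -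
  obtain a0 where a0: "a0 \<in> eff_dom (conjugate_fun f)" using eff_dom_conjugate_nonempty[OF f] .
  obtain b0 where b0: "b0 \<in> eff_dom (conjugate_fun g)" using eff_dom_conjugate_nonempty[OF g] .
  have le: "ereal (a \<bullet> d) \<le> recession_fun h d"
    if "closed_proper_convex h" "a \<in> eff_dom (conjugate_fun h)" for a h
    using that by (auto simp: recession_fun_eq_support intro: SUP_upper)
  from d have "recession_fun f d + recession_fun g d < 0"
    by (simp add: primal_improving_direction_def)
  with le[OF f a0] le[OF g b0]
  obtain s t where "recession_fun f d = ereal s" "recession_fun g d = ereal t" "s + t < 0"
    by (cases "recession_fun f d"; cases "recession_fun g d") auto
  with le[OF f] le[OF g] show ?thesis by (intro that[of s t]) auto
qed

lemma improving_direction_imp_dual_strongly_infeasible: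
  assumes f: "closed_proper_convex f" and g: "closed_proper_convex g"
    and d: "primal_improving_direction f g d"
  shows "dual_strongly_infeasible f g"
proof -
  obtain s t where st: "\<And>a. a \<in> eff_dom (conjugate_fun f) \<Longrightarrow> a \<bullet> d \<le> s"
    "\<And>b. b \<in> eff_dom (conjugate_fun g) \<Longrightarrow> b \<bullet> d \<le> t" "s + t < 0"
    using primal_improving_directionE[OF f g d] by metis
  have "closure (eff_dom (conjugate_fun f) + eff_dom (conjugate_fun g)) \<subseteq> {y. d \<bullet> y \<le> s + t}"
    using st(1,2) by (intro closure_minimal closed_halfspace_le)
      (auto elim!: set_plus_elim intro!: add_mono simp: inner_add_left inner_commute[of d])
  then show ?thesis using st(3) by (auto simp: dual_strongly_infeasible_def)
qed

text \<open>
  The projection inequality says that \<open>(norm w)\<^sup>2 \<le> w \<bullet> (a + b)\<close> for all \<open>a\<close> and \<open>b\<close> in the two domains. As the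
  variables \<open>a\<close> and \<open>b\<close> are independent, this bound splits into one for each function, and the two
  bounds can be chosen to add up exactly.
\<close>

lemma min_norm_direction:
  assumes f: "closed_proper_convex f" and g: "closed_proper_convex g"
    and inf: "dual_strongly_infeasible f g"
  obtains w s t where "w \<noteq> 0" "w \<in> closure (eff_dom (conjugate_fun f) + eff_dom (conjugate_fun g))"
    "\<And>a. a \<in> eff_dom (conjugate_fun f) \<Longrightarrow> a \<bullet> (- w) \<le> s"
    "\<And>b. b \<in> eff_dom (conjugate_fun g) \<Longrightarrow> b \<bullet> (- w) \<le> t"
    "s + t = - (norm w)\<^sup>2"
proof -
  define A where "A = eff_dom (conjugate_fun f)"
  define B where "B = eff_dom (conjugate_fun g)"
  obtain a0 where a0: "a0 \<in> A" using eff_dom_conjugate_nonempty[OF f] unfolding A_def .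
  obtain b0 where b0: "b0 \<in> B" using eff_dom_conjugate_nonempty[OF g] unfolding B_def .
  define w where "w = closest_point (closure (A + B)) 0"
  have ne: "closure (A + B) \<noteq> {}" using set_plus_intro[OF a0 b0] by auto
  have w_mem: "w \<in> closure (A + B)" unfolding w_def by (rule closest_point_in_set[OF closed_closure ne])
  have cvx: "convex (closure (A + B))"
    using convex_eff_dom_conjugate[OF f] convex_eff_dom_conjugate[OF g]
    unfolding A_def B_def by (intro convex_closure convex_set_plus)
  have w_min: "(norm w)\<^sup>2 \<le> w \<bullet> (a + b)" if "a \<in> A" "b \<in> B" for a b
  proof -
    have "a + b \<in> closure (A + B)" using set_plus_intro[OF that] closure_subset by (rule set_mp[rotated])
    from closest_point_dot[OF cvx closed_closure this, of 0]
    show ?thesis by (simp add: w_def[symmetric] inner_diff_right power2_norm_eq_inner)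
  qed
  define s where "s = (SUP a\<in>A. a \<bullet> (- w))"
  have le: "a \<bullet> (- w) \<le> - (norm w)\<^sup>2 - b \<bullet> (- w)" if "a \<in> A" "b \<in> B" for a b
    using w_min[OF that] by (simp add: inner_add_right inner_commute)
  have bdd: "bdd_above ((\<lambda>a. a \<bullet> (- w)) ` A)"
    using le[OF _ b0] by (intro bdd_aboveI2)
  have "a \<bullet> (- w) \<le> s" if "a \<in> A" for a
    unfolding s_def by (rule cSUP_upper[OF that bdd])
  moreover have "b \<bullet> (- w) \<le> - (norm w)\<^sup>2 - s" if "b \<in> B" for b
  proof -
    have "s \<le> - (norm w)\<^sup>2 - b \<bullet> (- w)"
      unfolding s_def using a0 le[OF _ that] by (intro cSUP_least) auto
    then show ?thesis by simp
  qed
  moreover have "w \<noteq> 0"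
    using w_mem inf by (auto simp: dual_strongly_infeasible_def A_def B_def)
  ultimately show ?thesis
    using w_mem by (intro that[of w s "- (norm w)\<^sup>2 - s"]) (auto simp: A_def B_def)
qed

section \<open>Orbits of firmly nonexpansive maps and growth of sequences\<close>

text \<open>
  The argument of Baillon, Bruck and Reich: the differences of consecutive steps tend to \<open>0\<close>, so
  far out any \<open>m\<close> consecutive steps nearly agree, and the displacement over \<open>m\<close> steps there has
  norm close to \<open>m M\<close>. By nonexpansiveness the displacement of the first \<open>m\<close> steps is at least as
  long, so \<open>M\<close> is at most the norm of the average displacement.
\<close>

lemma firmly_nonexpansive_orbit_step_norm:
  fixes z :: "nat \<Rightarrow> 'a::real_inner"
  assumes fne: "\<And>j k. (norm (z (Suc j) - z (Suc k)))\<^sup>2 +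
      (norm ((z j - z (Suc j)) - (z k - z (Suc k))))\<^sup>2 \<le> (norm (z j - z k))\<^sup>2"
    and rate: "(\<lambda>n. z n /\<^sub>R real n) \<longlonglongrightarrow> q"
  obtains M where "(\<lambda>k. norm (z k - z (Suc k))) \<longlonglongrightarrow> M" "M \<le> norm q"
proof -
  define \<delta> where "\<delta> k = z k - z (Suc k)" for k
  have step: "(norm (\<delta> (Suc k)))\<^sup>2 + (norm (\<delta> (Suc k) - \<delta> k))\<^sup>2 \<le> (norm (\<delta> k))\<^sup>2" for k
    using fne[of "Suc k" k] by (simp add: \<delta>_def norm_minus_commute)
  have nonexp: "norm (z (Suc j) - z (Suc k)) \<le> norm (z j - z k)" for j k
  proof (rule power2_le_imp_le)
    have "0 \<le> (norm ((z j - z (Suc j)) - (z k - z (Suc k))))\<^sup>2" by simp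
    with fne[of j k] show "(norm (z (Suc j) - z (Suc k)))\<^sup>2 \<le> (norm (z j - z k))\<^sup>2" by linarith
  qed simp
  have "norm (\<delta> (Suc k)) \<le> norm (\<delta> k)" for k
    using nonexp[of k "Suc k"] by (simp add: \<delta>_def)
  then have "decseq (\<lambda>k. norm (\<delta> k))" by (rule decseq_SucI)
  then obtain M where M: "(\<lambda>k. norm (\<delta> k)) \<longlonglongrightarrow> M"
    using decseq_convergent[of "\<lambda>k. norm (\<delta> k)" 0] by auto
  have "(\<lambda>k. (norm (\<delta> k))\<^sup>2 - (norm (\<delta> (Suc k)))\<^sup>2) \<longlonglongrightarrow> M\<^sup>2 - M\<^sup>2"
    by (intro tendsto_intros M LIMSEQ_Suc[OF M])
  then have "(\<lambda>k. (norm (\<delta> k))\<^sup>2 - (norm (\<delta> (Suc k)))\<^sup>2) \<longlonglongrightarrow> 0"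
    by simp
  then have "(\<lambda>k. (norm (\<delta> (Suc k) - \<delta> k))\<^sup>2) \<longlonglongrightarrow> 0"
    by (rule Lim_null_comparison[rotated])
      (rule always_eventually, use step in \<open>simp add: algebra_simps\<close>)
  then have "(\<lambda>k. norm (\<delta> (Suc k) - \<delta> k)) \<longlonglongrightarrow> 0"
    using tendsto_real_sqrt[of "\<lambda>k. (norm (\<delta> (Suc k) - \<delta> k))\<^sup>2" 0] by simp
  then have diff: "(\<lambda>k. \<delta> (Suc k) - \<delta> k) \<longlonglongrightarrow> 0" by (rule tendsto_norm_zero_cancel)
  have shift: "(\<lambda>k. \<delta> (k + m) - \<delta> k) \<longlonglongrightarrow> 0" for m
  proof (induction m)
    case (Suc m)
    have "(\<lambda>k. (\<delta> (Suc (k + m)) - \<delta> (k + m)) + (\<delta> (k + m) - \<delta> k)) \<longlonglongrightarrow> 0 + 0"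
      by (intro tendsto_add Suc.IH LIMSEQ_ignore_initial_segment[OF diff])
    then show ?case by simp
  qed simp
  have blockdiff: "(\<lambda>k. (z k - z (k + m)) - real m *\<^sub>R \<delta> k) \<longlonglongrightarrow> 0" for m
  proof (induction m)
    case (Suc m)
    have "(\<lambda>k. ((z k - z (k + m)) - real m *\<^sub>R \<delta> k) + (\<delta> (k + m) - \<delta> k)) \<longlonglongrightarrow> 0 + 0"
      by (intro tendsto_add Suc.IH shift)
    then show ?case by (simp add: \<delta>_def algebra_simps)
  qed simp
  have "real m * M \<le> norm (z 0 - z m)" for m
  proof -
    have "(\<lambda>k. norm (z k - z (k + m)) - norm (real m *\<^sub>R \<delta> k)) \<longlonglongrightarrow> 0"
      by (rule Lim_null_comparison[OF _ tendsto_norm_zero[OF blockdiff[of m]]])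
        (rule always_eventually, simp add: norm_triangle_ineq3 del: norm_scaleR)
    then have "(\<lambda>k. (norm (z k - z (k + m)) - norm (real m *\<^sub>R \<delta> k)) + real m * norm (\<delta> k)) \<longlonglongrightarrow> 0 + real m * M"
      by (intro tendsto_add tendsto_mult tendsto_const M)
    then have lim: "(\<lambda>k. norm (z k - z (k + m))) \<longlonglongrightarrow> real m * M" by simp
    have "norm (z k - z (k + m)) \<le> norm (z 0 - z m)" for k
    proof (induction k)
      case (Suc k)
      then show ?case using nonexp[of k "k + m"] by simp
    qed simp
    then show ?thesis by (intro LIMSEQ_le_const2[OF lim]) auto
  qed
  then have "M \<le> norm (z 0 - z m) / real m" if "m \<ge> 1" for m
    using that by (simp add: pos_le_divide_eq mult.commute)
  moreover have "norm (z 0 - z m) / real m = norm (z 0 /\<^sub>R real m - z m /\<^sub>R real m)" for m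
    by (simp add: divide_inverse mult.commute flip: scaleR_diff_right)
  ultimately have le: "M \<le> norm (z 0 /\<^sub>R real m - z m /\<^sub>R real m)" if "m \<ge> 1" for m
    using that by metis
  have "(\<lambda>m. norm (z 0 /\<^sub>R real m - z m /\<^sub>R real m)) \<longlonglongrightarrow> norm (0 *\<^sub>R z 0 - q)"
    by (intro tendsto_intros rate tendsto_scaleR tendsto_inverse_0_at_top filterlim_real_sequentially)
  then have "M \<le> norm q"
    using le by (intro LIMSEQ_le_const) (auto intro: exI[of _ 1])
  with M show ?thesis by (intro that) (auto simp: \<delta>_def)
qed

lemma subquadratic_growth:
  fixes E :: "nat \<Rightarrow> real"
  assumes nonneg: "\<And>n. 0 \<le> E n"
    and incr: "\<And>e. e > 0 \<Longrightarrow> \<exists>K. \<forall>k. E (Suc k) \<le> E k + e * real k + K"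
  shows "(\<lambda>n. E n / (real n)\<^sup>2) \<longlonglongrightarrow> 0"
proof (rule order_tendstoI)
  fix l :: real assume "l < 0"
  have "0 \<le> E n / (real n)\<^sup>2" for n using nonneg by simp
  with \<open>l < 0\<close> show "\<forall>\<^sub>F n in sequentially. l < E n / (real n)\<^sup>2"
    by (intro always_eventually allI) (rule less_le_trans)
next
  fix e :: real assume "0 < e"
  then obtain K where K: "\<And>k. E (Suc k) \<le> E k + e/2 * real k + K"
    using incr[of "e/2"] by auto
  have bound: "E n \<le> E 0 + e/2 * (real n)\<^sup>2 + K * real n" for n
  proof (induction n)
    case (Suc n)
    have "real n + (real n)\<^sup>2 \<le> (real (Suc n))\<^sup>2" by (simp add: power2_eq_square algebra_simps)
    then have "e/2 * (real n + (real n)\<^sup>2) \<le> e/2 * (real (Suc n))\<^sup>2"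
      using \<open>0 < e\<close> by (intro mult_left_mono) auto
    then have "e/2 * real n + e/2 * (real n)\<^sup>2 \<le> e/2 * (real (Suc n))\<^sup>2"
      by (simp only: distrib_left)
    moreover have "K * real (Suc n) = K * real n + K" by (simp add: algebra_simps)
    ultimately show ?case using Suc.IH K[of n] by linarith
  qed simp
  have "(\<lambda>n. E 0 * (inverse (real n))\<^sup>2 + e/2 + K * inverse (real n)) \<longlonglongrightarrow> E 0 * 0\<^sup>2 + e/2 + K * 0"
    by (intro tendsto_intros tendsto_inverse_0_at_top filterlim_real_sequentially)
  then have "\<forall>\<^sub>F n in sequentially. E 0 * (inverse (real n))\<^sup>2 + e/2 + K * inverse (real n) < e"
    by (rule order_tendstoD) (use \<open>0 < e\<close> in simp)
  with eventually_gt_at_top[of 0]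
  show "\<forall>\<^sub>F n in sequentially. E n / (real n)\<^sup>2 < e"
  proof eventually_elim
    case (elim n)
    have "E n / (real n)\<^sup>2 \<le> (E 0 + e/2 * (real n)\<^sup>2 + K * real n) / (real n)\<^sup>2"
      by (intro divide_right_mono bound) simp
    also have "\<dots> = E 0 * (inverse (real n))\<^sup>2 + e/2 + K * inverse (real n)"
      using elim(1) by (simp add: field_simps power2_eq_square)
    finally show ?case using elim(2) by simp
  qed
qed

section \<open>The Douglas--Rachford iteration\<close>

locale douglas_rachford =
  fixes f g :: "'a::euclidean_space \<Rightarrow> ereal" and \<gamma> :: real and z0 :: 'a
    and xh x z :: "nat \<Rightarrow> 'a"
  assumes f: "closed_proper_convex f" and g: "closed_proper_convex g"
    and \<gamma>: "\<gamma> > 0" and drs: "drs_iterates f g \<gamma> z0 xh x z"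
begin

text \<open>
  The residuals of the two proximal steps, scaled so as to be subgradients of \<open>f\<close> at
  \<open>xh k\<close> and of \<open>g\<close> at \<open>x (Suc k)\<close>.
\<close>

definition u :: "nat \<Rightarrow> 'a" where "u k = (z k - xh k) /\<^sub>R \<gamma>"
definition v :: "nat \<Rightarrow> 'a" where "v k = (2 *\<^sub>R xh k - z k - x (Suc k)) /\<^sub>R \<gamma>"
definition \<delta> :: "nat \<Rightarrow> 'a" where "\<delta> k = z k - z (Suc k)"

lemma z_eq: "z k = xh k + \<gamma> *\<^sub>R u k"
  using \<gamma> by (simp add: u_def)

lemma x_eq: "x (Suc k) = xh k - \<gamma> *\<^sub>R u k - \<gamma> *\<^sub>R v k"
  using \<gamma> by (simp add: u_def v_def scaleR_2)

lemma z_Suc_eq: "z (Suc k) = xh k - \<gamma> *\<^sub>R v k"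
proof -
  have "z (Suc k) = z k + x (Suc k) - xh k" using drs by (simp add: drs_iterates_def)
  then show ?thesis by (simp add: z_eq x_eq)
qed

lemma \<delta>_eq: "\<delta> k = \<gamma> *\<^sub>R (u k + v k)"
  by (simp add: \<delta>_def z_eq[of k] z_Suc_eq scaleR_add_right)

lemma xh_minus_x: "xh k - x (Suc k) = \<delta> k"
  by (simp add: \<delta>_eq x_eq scaleR_add_right)

lemma xh_dom: "xh k \<in> eff_dom f"
  and u_subgradient: "y \<in> eff_dom f \<Longrightarrow> rval f (xh k) + u k \<bullet> (y - xh k) \<le> rval f y"
proof -
  have "xh k = prox (\<lambda>y. ereal \<gamma> * f y) (z k)" using drs by (simp add: drs_iterates_def)
  from prox_mem_minimal(1)[OF f \<gamma> this] prox_subgradient[OF f \<gamma> this]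
  show "xh k \<in> eff_dom f" "y \<in> eff_dom f \<Longrightarrow> rval f (xh k) + u k \<bullet> (y - xh k) \<le> rval f y"
    by (auto simp: u_def)
qed

lemma x_dom: "x (Suc k) \<in> eff_dom g"
  and v_subgradient: "y \<in> eff_dom g \<Longrightarrow> rval g (x (Suc k)) + v k \<bullet> (y - x (Suc k)) \<le> rval g y"
proof -
  have "x (Suc k) = prox (\<lambda>y. ereal \<gamma> * g y) (2 *\<^sub>R xh k - z k)"
    using drs by (simp add: drs_iterates_def)
  from prox_mem_minimal(1)[OF g \<gamma> this] prox_subgradient[OF g \<gamma> this]
  show "x (Suc k) \<in> eff_dom g"
    "y \<in> eff_dom g \<Longrightarrow> rval g (x (Suc k)) + v k \<bullet> (y - x (Suc k)) \<le> rval g y"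
    by (auto simp: v_def)
qed

lemma u_mem: "u k \<in> eff_dom (conjugate_fun f)"
  by (rule subgradient_mem_eff_dom_conjugate[OF f u_subgradient])

lemma v_mem: "v k \<in> eff_dom (conjugate_fun g)"
  by (rule subgradient_mem_eff_dom_conjugate[OF g v_subgradient])

lemma u_monotone: "0 \<le> (u j - u k) \<bullet> (xh j - xh k)"
  using u_subgradient[OF xh_dom, of j k] u_subgradient[OF xh_dom, of k j]
  by (simp add: inner_diff_left inner_diff_right)

lemma v_monotone: "0 \<le> (v j - v k) \<bullet> (x (Suc j) - x (Suc k))"
  using v_subgradient[OF x_dom, of j k] v_subgradient[OF x_dom, of k j]
  by (simp add: inner_diff_left inner_diff_right)

text \<open>
  The difference of the two sides is \<open>2 \<gamma>\<close> times the sum of the monotonicity expressions of the two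
  subdifferentials.
\<close>

lemma firmly_nonexpansive:
  "(norm (z (Suc j) - z (Suc k)))\<^sup>2 + (norm (\<delta> j - \<delta> k))\<^sup>2 \<le> (norm (z j - z k))\<^sup>2"
proof -
  define X U V where "X = xh j - xh k" and "U = u j - u k" and "V = v j - v k"
  have eqs: "z (Suc j) - z (Suc k) = X - \<gamma> *\<^sub>R V" "\<delta> j - \<delta> k = \<gamma> *\<^sub>R (U + V)"
    "z j - z k = X + \<gamma> *\<^sub>R U" "x (Suc j) - x (Suc k) = X - \<gamma> *\<^sub>R U - \<gamma> *\<^sub>R V"
    by (simp_all add: X_def U_def V_def z_Suc_eq \<delta>_eq z_eq[of j] z_eq[of k] x_eq algebra_simps)
  have "0 \<le> 2 * \<gamma> * (U \<bullet> X + V \<bullet> (X - \<gamma> *\<^sub>R U - \<gamma> *\<^sub>R V))"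
    using u_monotone[of j k] v_monotone[of j k] \<gamma> eqs(4)
    by (simp add: X_def[symmetric] U_def[symmetric] V_def[symmetric])
  also have "\<dots> = (norm (X + \<gamma> *\<^sub>R U))\<^sup>2 - ((norm (X - \<gamma> *\<^sub>R V))\<^sup>2 + (norm (\<gamma> *\<^sub>R (U + V)))\<^sup>2)"
    unfolding power2_norm_eq_inner
    by (simp add: inner_diff_left inner_diff_right inner_add_left inner_add_right inner_commute
        power2_eq_square algebra_simps)
  finally show ?thesis by (simp add: eqs)
qed

lemma \<delta>_bounded: "norm (\<delta> k) \<le> norm (\<delta> 0)"
proof (induction k)
  case (Suc k)
  have "(norm (\<delta> (Suc k)))\<^sup>2 \<le> (norm (\<delta> k))\<^sup>2"
    using firmly_nonexpansive[of k "Suc k"] zero_le_power2[of "norm (\<delta> k - \<delta> (Suc k))"]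
    unfolding \<delta>_def by linarith
  then have "norm (\<delta> (Suc k)) \<le> norm (\<delta> k)"
    by (rule power2_le_imp_le) simp
  with Suc.IH show ?case by simp
qed simp

lemma xh_growth: "norm (xh k) \<le> norm (xh 0) + real k * norm (\<delta> 0)"
proof -
  have "norm (z k - z 0) \<le> real k * norm (\<delta> 0)"
  proof (induction k)
    case (Suc k)
    have "norm (z (Suc k) - z 0) \<le> norm (z k - z 0) + norm (\<delta> k)"
      using norm_triangle_ineq4[of "z k - z 0" "\<delta> k"] by (simp add: \<delta>_def)
    then show ?case using Suc.IH \<delta>_bounded[of k] by (simp add: algebra_simps)
  qed simp
  moreover have "norm (xh k - xh 0) \<le> norm (z k - z 0)"
  proof (rule power2_le_imp_le)
    have "z k - z 0 = (xh k - xh 0) + \<gamma> *\<^sub>R (u k - u 0)"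
      by (simp add: z_eq[of k] z_eq[of 0] algebra_simps)
    then have "(norm (z k - z 0))\<^sup>2 = (norm (xh k - xh 0))\<^sup>2
        + 2 * \<gamma> * ((u k - u 0) \<bullet> (xh k - xh 0)) + (norm (\<gamma> *\<^sub>R (u k - u 0)))\<^sup>2"
      by (simp add: power2_norm_eq_inner inner_add_left inner_add_right inner_commute del: norm_scaleR)
    moreover have "0 \<le> 2 * \<gamma> * ((u k - u 0) \<bullet> (xh k - xh 0))"
      using u_monotone[of k 0] \<gamma> by simp
    moreover have "0 \<le> (norm (\<gamma> *\<^sub>R (u k - u 0)))\<^sup>2" by (rule zero_le_power2)
    ultimately show "(norm (xh k - xh 0))\<^sup>2 \<le> (norm (z k - z 0))\<^sup>2" by linarith
  qed simp
  ultimately show ?thesis using norm_triangle_sub[of "xh k" "xh 0"] by linarith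
qed

definition \<phi> :: "nat \<Rightarrow> real"
  where "\<phi> k = rval f (xh k) + rval g (x (Suc k))"

text \<open>
  The subgradient inequalities at \<open>xh k\<close> and \<open>x (Suc k)\<close>, added; the inner products collapse
  because \<open>\<delta> k = \<gamma> (u k + v k)\<close>.
\<close>

lemma \<phi>_le:
  assumes "p \<in> eff_dom f" "p \<in> eff_dom g"
  shows "\<phi> k \<le> rval f p + rval g p + \<delta> k \<bullet> (z (Suc k) - p) / \<gamma>"
proof -
  have "\<delta> k \<bullet> (z (Suc k) - p) / \<gamma> = (u k + v k) \<bullet> (xh k - \<gamma> *\<^sub>R v k - p)"
    using \<gamma> by (simp add: \<delta>_eq z_Suc_eq)
  also have "\<dots> = - (u k \<bullet> (p - xh k)) - v k \<bullet> (p - x (Suc k))"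
    by (simp add: x_eq inner_add_left inner_diff_right inner_add_right inner_commute algebra_simps)
  finally show ?thesis
    using u_subgradient[OF assms(1), of k] v_subgradient[OF assms(2), of k]
    by (simp add: \<phi>_def)
qed

end

section \<open>Linear escape along the least-norm direction\<close>

text \<open>
  A feasible point \<open>p\<close> and the data delivered by \<open>min_norm_direction\<close>. The vector \<open>w\<close> need not
  be attained as a sum \<open>a + b\<close>, only approximated, which is why the lower bound \<open>\<phi>_ge\<close> has an error
  that is linear in \<open>k\<close> with an arbitrarily small factor.
\<close>

locale douglas_rachford_min_norm = douglas_rachford +
  fixes w p :: 'a and s t :: real
  assumes w_closure: "w \<in> closure (eff_dom (conjugate_fun f) + eff_dom (conjugate_fun g))"
    and s: "\<And>a. a \<in> eff_dom (conjugate_fun f) \<Longrightarrow> a \<bullet> (- w) \<le> s"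
    and t: "\<And>b. b \<in> eff_dom (conjugate_fun g) \<Longrightarrow> b \<bullet> (- w) \<le> t"
    and st: "s + t = - (norm w)\<^sup>2"
    and p_f: "p \<in> eff_dom f" and p_g: "p \<in> eff_dom g"
begin

lemma \<delta>_inner_ge: "\<gamma> * (norm w)\<^sup>2 \<le> \<delta> k \<bullet> w"
proof -
  have "(norm w)\<^sup>2 \<le> (u k + v k) \<bullet> w"
    using s[OF u_mem, of k] t[OF v_mem, of k] st by (simp add: inner_add_left)
  then show ?thesis using \<gamma> by (simp add: \<delta>_eq)
qed

lemma \<delta>_inner_le: "\<bar>\<delta> k \<bullet> w\<bar> \<le> norm (\<delta> 0) * norm w"
  using Cauchy_Schwarz_ineq2[of "\<delta> k" w] mult_right_mono[OF \<delta>_bounded[of k] norm_ge_zero[of w]]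
  by linarith

text \<open>
  Replacing \<open>x (Suc k)\<close> by \<open>z (Suc k)\<close> costs \<open>\<gamma> (u k \<bullet> w)\<close>, which stays bounded above although \<open>u k\<close>
  itself may grow: \<open>(u k + v k) \<bullet> w\<close> is bounded, and \<open>v k \<bullet> w\<close> is bounded below by \<open>- t\<close>.
  Replacing \<open>a + b\<close> by \<open>w\<close> costs at most \<open>\<eta>\<close> times the norm of \<open>x (Suc k)\<close>, and iterates grow at most linearly.
\<close>

lemma \<phi>_ge:
  assumes "e > 0"
  obtains K where "\<And>k. w \<bullet> z (Suc k) - e * real k - K \<le> \<phi> k"
proof -
  \<comment> \<open>With this factor the part of the error that grows with \<open>k\<close> is at most \<open>e k\<close>.\<close>
  define \<eta> where "\<eta> = e / (norm (\<delta> 0) + 1)"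
  have "\<eta> > 0" using assms by (simp add: \<eta>_def add_nonneg_pos)
  have "e * norm (\<delta> 0) \<le> e * (norm (\<delta> 0) + 1)" using assms by simp
  then have \<eta>e: "\<eta> * norm (\<delta> 0) \<le> e" by (simp add: \<eta>_def pos_divide_le_eq add_nonneg_pos)
  obtain y where y: "y \<in> eff_dom (conjugate_fun f) + eff_dom (conjugate_fun g)" "dist y w < \<eta>"
    using w_closure \<open>\<eta> > 0\<close> unfolding closure_approachable by blast
  obtain a b where a: "a \<in> eff_dom (conjugate_fun f)" and b: "b \<in> eff_dom (conjugate_fun g)"
    and "y = a + b"
    using y(1) by (rule set_plus_elim)
  with y(2) have ab: "dist (a + b) w < \<eta>" by simp
  obtain ca where ca: "\<And>y. y \<in> eff_dom f \<Longrightarrow> a \<bullet> y - ca \<le> rval f y"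
    using a unfolding mem_eff_dom_conjugate_iff[OF f] by blast
  obtain cb where cb: "\<And>y. y \<in> eff_dom g \<Longrightarrow> b \<bullet> y - cb \<le> rval g y"
    using b unfolding mem_eff_dom_conjugate_iff[OF g] by blast
  define K where "K = norm a * norm (\<delta> 0) + \<eta> * (norm (xh 0) + norm (\<delta> 0)) + norm (\<delta> 0) * norm w
    + \<gamma> * t + ca + cb"
  have "w \<bullet> z (Suc k) - e * real k - K \<le> \<phi> k" for k
  proof -
    have 1: "a \<bullet> \<delta> k + (a + b) \<bullet> x (Suc k) - ca - cb \<le> \<phi> k"
      using ca[OF xh_dom, of k] cb[OF x_dom, of k] xh_minus_x[of k]
      by (simp add: \<phi>_def inner_add_left inner_diff_right flip: xh_minus_x)
    have 2: "- (norm a * norm (\<delta> 0)) \<le> a \<bullet> \<delta> k"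
      using Cauchy_Schwarz_ineq2[of a "\<delta> k"] mult_left_mono[OF \<delta>_bounded[of k] norm_ge_zero[of a]]
      by linarith
    have 3: "w \<bullet> x (Suc k) - \<eta> * (norm (xh 0) + norm (\<delta> 0)) - e * real k \<le> (a + b) \<bullet> x (Suc k)"
    proof -
      have "norm (x (Suc k)) \<le> norm (xh k) + norm (\<delta> k)"
        using norm_triangle_ineq4[of "xh k" "\<delta> k"] by (simp flip: xh_minus_x)
      also have "\<dots> \<le> norm (xh 0) + norm (\<delta> 0) + real k * norm (\<delta> 0)"
        using xh_growth[of k] \<delta>_bounded[of k] by simp
      finally have "\<eta> * norm (x (Suc k)) \<le> \<eta> * (norm (xh 0) + norm (\<delta> 0) + real k * norm (\<delta> 0))"
        using \<open>\<eta> > 0\<close> by simp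
      also have "\<dots> = \<eta> * (norm (xh 0) + norm (\<delta> 0)) + \<eta> * norm (\<delta> 0) * real k"
        by (simp add: algebra_simps)
      also have "\<dots> \<le> \<eta> * (norm (xh 0) + norm (\<delta> 0)) + e * real k"
        using \<eta>e by (intro add_left_mono mult_right_mono) auto
      finally have "\<eta> * norm (x (Suc k)) \<le> \<eta> * (norm (xh 0) + norm (\<delta> 0)) + e * real k" .
      moreover have "\<bar>(a + b - w) \<bullet> x (Suc k)\<bar> \<le> \<eta> * norm (x (Suc k))"
        using Cauchy_Schwarz_ineq2[of "a + b - w" "x (Suc k)"] ab
          mult_right_mono[of "norm (a + b - w)" \<eta> "norm (x (Suc k))"]
        by (simp add: dist_norm)
      ultimately show ?thesis by (simp only: inner_diff_left abs_le_iff) linarith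
    qed
    have 4: "w \<bullet> z (Suc k) - norm (\<delta> 0) * norm w - \<gamma> * t \<le> w \<bullet> x (Suc k)"
    proof -
      have "x (Suc k) = z (Suc k) - \<delta> k + \<gamma> *\<^sub>R v k"
        by (simp add: x_eq z_Suc_eq \<delta>_eq algebra_simps)
      then have "w \<bullet> x (Suc k) = w \<bullet> z (Suc k) - \<delta> k \<bullet> w + \<gamma> * (v k \<bullet> w)"
        by (simp add: inner_add_right inner_diff_right inner_commute)
      moreover have "\<gamma> * (- t) \<le> \<gamma> * (v k \<bullet> w)"
        using t[OF v_mem, of k] \<gamma> by (intro mult_left_mono) auto
      ultimately show ?thesis using \<delta>_inner_le[of k] by simp
    qed
    show ?thesis using 1 2 3 4 unfolding K_def by linarith
  qed
  then show ?thesis by (rule that)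
qed

text \<open>
  The position of \<open>z k\<close> relative to the feasible point that moves with the expected velocity.
\<close>

definition \<zeta> :: "nat \<Rightarrow> 'a"
  where "\<zeta> k = z k - (p - (real k * \<gamma>) *\<^sub>R w)"

text \<open>
  Comparing \<open>\<phi>_ge\<close> with \<open>\<phi>_le\<close> at the moving feasible point, the terms \<open>k \<gamma> (norm w)\<^sup>2\<close> cancel, and what
  remains bounds \<open>(\<zeta> (Suc k) - \<zeta> k) \<bullet> \<zeta> (Suc k)\<close>, where \<open>\<zeta> (Suc k) - \<zeta> k = \<gamma> w - \<delta> k\<close>.
\<close>

lemma \<zeta>_recurrence:
  assumes "e > 0"
  shows "\<exists>K. \<forall>k. (norm (\<zeta> (Suc k)))\<^sup>2 \<le> (norm (\<zeta> k))\<^sup>2 + e * real k + K"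
proof -
  obtain K where K: "\<And>k. w \<bullet> z (Suc k) - e / (2 * \<gamma>) * real k - K \<le> \<phi> k"
    using \<phi>_ge[of "e / (2 * \<gamma>)"] assms \<gamma> by auto
  define C where "C = K + rval f p + rval g p - w \<bullet> p + \<gamma> * (norm w)\<^sup>2 + norm (\<delta> 0) * norm w"
  have "(norm (\<zeta> (Suc k)))\<^sup>2 \<le> (norm (\<zeta> k))\<^sup>2 + e * real k + 2 * \<gamma> * C" for k
  proof -
    let ?p = "p + (real k * \<gamma>) *\<^sub>R (- w)"
    have k\<gamma>: "0 \<le> real k * \<gamma>" using \<gamma> by simp
    note pf = rval_add_le_of_conjugate_dom_bound[OF f p_f k\<gamma> s]
      and pg = rval_add_le_of_conjugate_dom_bound[OF g p_g k\<gamma> t]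
    have "rval f ?p + rval g ?p \<le> rval f p + rval g p + real k * \<gamma> * (s + t)"
      using pf(2) pg(2) by (simp add: distrib_left)
    then have val: "rval f ?p + rval g ?p \<le> rval f p + rval g p - real k * \<gamma> * (norm w)\<^sup>2"
      by (simp add: st)
    have z: "z (Suc k) = \<zeta> (Suc k) + p - (real k * \<gamma>) *\<^sub>R w - \<gamma> *\<^sub>R w"
      by (simp add: \<zeta>_def algebra_simps)
    have step: "\<zeta> k = \<zeta> (Suc k) + \<delta> k - \<gamma> *\<^sub>R w"
      by (simp add: \<zeta>_def \<delta>_def algebra_simps)
    have "w \<bullet> z (Suc k) - e / (2 * \<gamma>) * real k - K \<le>
        rval f p + rval g p - real k * \<gamma> * (norm w)\<^sup>2 + \<delta> k \<bullet> (z (Suc k) - ?p) / \<gamma>"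
      using K[of k] \<phi>_le[OF pf(1) pg(1), of k] val by linarith
    moreover have "w \<bullet> z (Suc k) = w \<bullet> \<zeta> (Suc k) + w \<bullet> p - real k * \<gamma> * (norm w)\<^sup>2 - \<gamma> * (norm w)\<^sup>2"
      by (simp add: z inner_add_right inner_diff_right power2_norm_eq_inner)
    moreover have "\<delta> k \<bullet> (z (Suc k) - ?p) / \<gamma> = \<delta> k \<bullet> \<zeta> (Suc k) / \<gamma> - \<delta> k \<bullet> w"
      using \<gamma> by (simp add: z inner_add_right inner_diff_right diff_divide_distrib)
    ultimately have "w \<bullet> \<zeta> (Suc k) - \<delta> k \<bullet> \<zeta> (Suc k) / \<gamma> \<le> e / (2 * \<gamma>) * real k + C"
      using \<delta>_inner_le[of k] unfolding C_def by linarith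
    then have "2 * \<gamma> * (w \<bullet> \<zeta> (Suc k) - \<delta> k \<bullet> \<zeta> (Suc k) / \<gamma>) \<le> 2 * \<gamma> * (e / (2 * \<gamma>) * real k + C)"
      using \<gamma> by (intro mult_left_mono) auto
    then have ineq: "2 * ((\<gamma> *\<^sub>R w - \<delta> k) \<bullet> \<zeta> (Suc k)) \<le> e * real k + 2 * \<gamma> * C"
      using \<gamma> by (simp add: inner_diff_left algebra_simps)
    have norm_diff_sq: "(norm (a - b))\<^sup>2 = (norm a)\<^sup>2 - 2 * (b \<bullet> a) + (norm b)\<^sup>2" for a b :: 'a
      by (simp add: power2_norm_eq_inner inner_diff_left inner_diff_right inner_commute)
    have "(norm (\<zeta> k))\<^sup>2 = (norm (\<zeta> (Suc k) - (\<gamma> *\<^sub>R w - \<delta> k)))\<^sup>2"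
      by (simp add: step algebra_simps)
    also have "\<dots> = (norm (\<zeta> (Suc k)))\<^sup>2 - 2 * ((\<gamma> *\<^sub>R w - \<delta> k) \<bullet> \<zeta> (Suc k)) + (norm (\<gamma> *\<^sub>R w - \<delta> k))\<^sup>2"
      by (rule norm_diff_sq)
    finally show ?thesis using ineq zero_le_power2[of "norm (\<gamma> *\<^sub>R w - \<delta> k)"] by linarith
  qed
  then show ?thesis by blast
qed

lemma z_rate: "(\<lambda>n. z n /\<^sub>R real n) \<longlonglongrightarrow> - (\<gamma> *\<^sub>R w)"
proof -
  have "(\<lambda>n. (norm (\<zeta> n))\<^sup>2 / (real n)\<^sup>2) \<longlonglongrightarrow> 0"
    by (rule subquadratic_growth) (auto intro: \<zeta>_recurrence)
  then have "(\<lambda>n. sqrt ((norm (\<zeta> n /\<^sub>R real n))\<^sup>2)) \<longlonglongrightarrow> sqrt 0"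
    by (intro tendsto_real_sqrt) (simp add: power_mult_distrib divide_inverse mult.commute power_inverse)
  then have "(\<lambda>n. norm (\<zeta> n /\<^sub>R real n)) \<longlonglongrightarrow> 0" by (simp only: real_sqrt_abs abs_norm_cancel real_sqrt_zero)
  then have "(\<lambda>n. \<zeta> n /\<^sub>R real n) \<longlonglongrightarrow> 0" by (rule tendsto_norm_zero_cancel)
  then have "(\<lambda>n. \<zeta> n /\<^sub>R real n + p /\<^sub>R real n - \<gamma> *\<^sub>R w) \<longlonglongrightarrow> 0 + 0 *\<^sub>R p - \<gamma> *\<^sub>R w"
    by (intro tendsto_intros tendsto_inverse_0_at_top filterlim_real_sequentially)
  moreover have "\<forall>\<^sub>F n in sequentially. \<zeta> n /\<^sub>R real n + p /\<^sub>R real n - \<gamma> *\<^sub>R w = z n /\<^sub>R real n"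
    using eventually_gt_at_top[of 0]
  proof eventually_elim
    case (elim n)
    have "\<zeta> n /\<^sub>R real n + p /\<^sub>R real n = (\<zeta> n + p) /\<^sub>R real n" by (simp add: scaleR_add_right)
    also have "\<zeta> n + p = z n + (real n * \<gamma>) *\<^sub>R w" by (simp add: \<zeta>_def)
    finally show ?case using elim by (simp add: scaleR_add_right)
  qed
  ultimately show ?thesis using Lim_transform_eventually by fastforce
qed

text \<open>
  All steps lie in the half-space where \<open>\<gamma> (norm w)\<^sup>2 \<le> y \<bullet> w\<close>, whose point of least norm is \<open>\<gamma> w\<close>, and their norms
  tend to that least norm.
\<close>

lemma \<delta>_tendsto: "\<delta> \<longlonglongrightarrow> \<gamma> *\<^sub>R w"
proof -
  obtain M where M: "(\<lambda>k. norm (\<delta> k)) \<longlonglongrightarrow> M" "M \<le> \<gamma> * norm w"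
    using firmly_nonexpansive_orbit_step_norm[OF firmly_nonexpansive[unfolded \<delta>_def] z_rate] \<gamma>
    unfolding \<delta>_def by auto
  have "0 \<le> M" by (rule LIMSEQ_le_const[OF M(1)]) simp
  with M(2) have "M\<^sup>2 \<le> (\<gamma> * norm w)\<^sup>2" by (rule power_mono)
  have le: "(norm (\<delta> k - \<gamma> *\<^sub>R w))\<^sup>2 \<le> (norm (\<delta> k))\<^sup>2 - (\<gamma> * norm w)\<^sup>2" for k
  proof -
    have "(norm (\<delta> k - \<gamma> *\<^sub>R w))\<^sup>2 = (norm (\<delta> k))\<^sup>2 - 2 * \<gamma> * (\<delta> k \<bullet> w) + \<gamma> * (\<gamma> * (norm w)\<^sup>2)"
      by (simp add: power2_norm_eq_inner inner_diff_left inner_diff_right inner_commute)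
    moreover have "\<gamma> * (\<gamma> * (norm w)\<^sup>2) \<le> \<gamma> * (\<delta> k \<bullet> w)"
      using \<delta>_inner_ge[of k] \<gamma> by simp
    ultimately show ?thesis by (simp add: power2_eq_square)
  qed
  have lim: "(\<lambda>k. (norm (\<delta> k))\<^sup>2 - (\<gamma> * norm w)\<^sup>2) \<longlonglongrightarrow> M\<^sup>2 - (\<gamma> * norm w)\<^sup>2"
    by (intro tendsto_intros M)
  have "0 \<le> M\<^sup>2 - (\<gamma> * norm w)\<^sup>2"
    by (rule LIMSEQ_le_const[OF lim]) (use le order_trans[OF zero_le_power2] in blast)
  with \<open>M\<^sup>2 \<le> (\<gamma> * norm w)\<^sup>2\<close> lim
  have "(\<lambda>k. (norm (\<delta> k))\<^sup>2 - (\<gamma> * norm w)\<^sup>2) \<longlonglongrightarrow> 0" by simp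
  then have "(\<lambda>k. (norm (\<delta> k - \<gamma> *\<^sub>R w))\<^sup>2) \<longlonglongrightarrow> 0"
    by (rule Lim_null_comparison[rotated]) (rule always_eventually, use le in simp)
  then have "(\<lambda>k. norm (\<delta> k - \<gamma> *\<^sub>R w)) \<longlonglongrightarrow> 0"
    using tendsto_real_sqrt[of "\<lambda>k. (norm (\<delta> k - \<gamma> *\<^sub>R w))\<^sup>2" 0] by simp
  then have "(\<lambda>k. \<delta> k - \<gamma> *\<^sub>R w) \<longlonglongrightarrow> 0" by (rule tendsto_norm_zero_cancel)
  then show ?thesis by (rule LIM_zero_cancel)
qed

section \<open>Consequences for the iterates\<close>

text \<open>
  In \<open>\<phi>_le\<close> with the fixed point \<open>p\<close>, the step tends to \<open>\<gamma> w\<close> and \<open>z (Suc k)\<close> is asymptotically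
  \<open>- k \<gamma> w\<close>.
\<close>

lemma \<phi>_at_bot:
  assumes "w \<noteq> 0"
  shows "filterlim \<phi> at_bot sequentially"
proof -
  have "(\<lambda>k. p /\<^sub>R real (Suc k)) \<longlonglongrightarrow> 0 *\<^sub>R p"
    by (rule tendsto_scaleR[OF LIMSEQ_inverse_real_of_nat tendsto_const])
  from tendsto_divide[OF tendsto_inner[OF \<delta>_tendsto tendsto_diff[OF LIMSEQ_Suc[OF z_rate] this]] tendsto_const, of \<gamma>]
  have "(\<lambda>k. \<delta> k \<bullet> (z (Suc k) /\<^sub>R real (Suc k) - p /\<^sub>R real (Suc k)) / \<gamma>)
      \<longlonglongrightarrow> (\<gamma> *\<^sub>R w) \<bullet> (- (\<gamma> *\<^sub>R w) - 0 *\<^sub>R p) / \<gamma>"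
    using \<gamma> by simp
  moreover have "(\<gamma> *\<^sub>R w) \<bullet> (- (\<gamma> *\<^sub>R w) - 0 *\<^sub>R p) / \<gamma> < 0"
    using \<gamma> assms by simp
  moreover have "filterlim (\<lambda>k. real (Suc k)) at_top sequentially"
    by (rule filterlim_compose[OF filterlim_real_sequentially filterlim_Suc])
  ultimately have lim: "filterlim (\<lambda>k. \<delta> k \<bullet> (z (Suc k) /\<^sub>R real (Suc k) - p /\<^sub>R real (Suc k)) / \<gamma> * real (Suc k)) at_bot sequentially"
    by (rule filterlim_tendsto_neg_mult_at_bot)
  have "\<delta> k \<bullet> (z (Suc k) /\<^sub>R real (Suc k) - p /\<^sub>R real (Suc k)) / \<gamma> * real (Suc k) = \<delta> k \<bullet> (z (Suc k) - p) / \<gamma>" for k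
    unfolding scaleR_diff_right[symmetric] inner_scaleR_right by (simp add: field_simps del: of_nat_Suc)
  with lim have lim: "filterlim (\<lambda>k. \<delta> k \<bullet> (z (Suc k) - p) / \<gamma>) at_bot sequentially"
    by (simp only:)
  show ?thesis
    unfolding filterlim_at_bot
  proof
    fix Z
    have "\<forall>\<^sub>F k in sequentially. \<delta> k \<bullet> (z (Suc k) - p) / \<gamma> \<le> Z - (rval f p + rval g p)"
      using lim unfolding filterlim_at_bot by blast
    then show "\<forall>\<^sub>F k in sequentially. \<phi> k \<le> Z"
    proof eventually_elim
      case (elim k)
      then show ?case using \<phi>_le[OF p_f p_g, of k] by simp
    qed
  qed
qed

lemma value_tendsto_MInf:
  assumes "w \<noteq> 0"
  shows "(\<lambda>k. f (xh k) + g (x (Suc k))) \<longlonglongrightarrow> -\<infinity>"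
proof -
  have eq: "f (xh k) + g (x (Suc k)) = ereal (\<phi> k)" for k
  proof -
    obtain r where "f (xh k) = ereal r" using eff_domE[OF f xh_dom] .
    moreover obtain q where "g (x (Suc k)) = ereal q" using eff_domE[OF g x_dom] .
    ultimately show ?thesis by (simp add: \<phi>_def)
  qed
  show ?thesis
    unfolding eq tendsto_MInfty using \<phi>_at_bot[OF assms] by (simp add: filterlim_at_bot_dense)
qed

text \<open>
  Along convergent iterates the affine minorants would bound \<open>\<phi>\<close> from below.
\<close>

lemma not_convergent:
  assumes "w \<noteq> 0"
  shows "\<not> convergent (\<lambda>k. (xh k, x (Suc k)))"
proof
  assume "convergent (\<lambda>k. (xh k, x (Suc k)))"
  then obtain l where "(\<lambda>k. (xh k, x (Suc k))) \<longlonglongrightarrow> l" by (auto simp: convergent_def)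
  then have xh: "xh \<longlonglongrightarrow> fst l" and x: "(\<lambda>k. x (Suc k)) \<longlonglongrightarrow> snd l"
    using tendsto_fst[of "\<lambda>k. (xh k, x (Suc k))"] tendsto_snd[of "\<lambda>k. (xh k, x (Suc k))"] by auto
  obtain a where "a \<in> eff_dom (conjugate_fun f)" using eff_dom_conjugate_nonempty[OF f] .
  then obtain ca where ca: "\<And>y. y \<in> eff_dom f \<Longrightarrow> a \<bullet> y - ca \<le> rval f y"
    unfolding mem_eff_dom_conjugate_iff[OF f] by blast
  obtain b where "b \<in> eff_dom (conjugate_fun g)" using eff_dom_conjugate_nonempty[OF g] .
  then obtain cb where cb: "\<And>y. y \<in> eff_dom g \<Longrightarrow> b \<bullet> y - cb \<le> rval g y"
    unfolding mem_eff_dom_conjugate_iff[OF g] by blast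
  have "(\<lambda>k. a \<bullet> xh k - ca + (b \<bullet> x (Suc k) - cb)) \<longlonglongrightarrow> a \<bullet> fst l - ca + (b \<bullet> snd l - cb)"
    by (intro tendsto_intros xh x)
  moreover have "filterlim (\<lambda>k. a \<bullet> xh k - ca + (b \<bullet> x (Suc k) - cb)) at_bot sequentially"
    using \<phi>_at_bot[OF assms]
    by (rule filterlim_at_bot_mono)
      (auto simp: \<phi>_def intro!: always_eventually add_mono ca cb xh_dom x_dom)
  ultimately show False
    using not_tendsto_and_filterlim_at_infinity[OF sequentially_bot]
      filterlim_at_bot_imp_at_infinity by blast
qed

lemma infdist_x_tendsto: "(\<lambda>k. infdist (x (Suc k)) (eff_dom f)) \<longlonglongrightarrow> 0"
proof -
  have "(\<lambda>k. norm (\<delta> k - \<gamma> *\<^sub>R w)) \<longlonglongrightarrow> 0"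
    using \<delta>_tendsto by (simp add: LIM_zero tendsto_norm_zero)
  then show ?thesis
  proof (rule Lim_null_comparison[rotated], intro always_eventually allI)
    fix k
    \<comment> \<open>The bound on the growth along \<open>- w\<close> in particular keeps the translate in the domain.\<close>
    have "xh k + \<gamma> *\<^sub>R (- w) \<in> eff_dom f"
      using rval_add_le_of_conjugate_dom_bound(1)[OF f xh_dom _ s] \<gamma> by simp
    then have "infdist (x (Suc k)) (eff_dom f) \<le> dist (x (Suc k)) (xh k + \<gamma> *\<^sub>R (- w))"
      by (rule infdist_le)
    also have "\<dots> = norm (\<delta> k - \<gamma> *\<^sub>R w)"
      by (simp add: dist_norm algebra_simps norm_minus_commute flip: xh_minus_x)
    finally show "norm (infdist (x (Suc k)) (eff_dom f)) \<le> norm (\<delta> k - \<gamma> *\<^sub>R w)"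
      by (simp add: infdist_nonneg)
  qed
qed

text \<open>
  Both \<open>u k \<bullet> w \<ge> - s\<close> and \<open>v k \<bullet> w \<ge> - t\<close> hold, while the sum of the left-hand sides tends to
  \<open>(norm w)\<^sup>2\<close>, the sum of the right-hand sides; so both inequalities are asymptotically tight.
\<close>

lemma u_inner_tendsto: "(\<lambda>k. u k \<bullet> w) \<longlonglongrightarrow> - s"
proof -
  have lower: "- s \<le> u k \<bullet> w" for k
    using s[OF u_mem, of k] by simp
  have upper: "u k \<bullet> w \<le> \<delta> k \<bullet> w / \<gamma> + t" for k
    using t[OF v_mem, of k] \<gamma> by (simp add: \<delta>_eq inner_add_left)
  have "(\<lambda>k. \<delta> k \<bullet> w / \<gamma> + t) \<longlonglongrightarrow> (\<gamma> *\<^sub>R w) \<bullet> w / \<gamma> + t"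
    by (intro tendsto_intros \<delta>_tendsto) (use \<gamma> in simp)
  moreover have "(\<gamma> *\<^sub>R w) \<bullet> w / \<gamma> + t = - s"
    using st \<gamma> by (simp add: power2_norm_eq_inner)
  ultimately have lim: "(\<lambda>k. \<delta> k \<bullet> w / \<gamma> + t) \<longlonglongrightarrow> - s" by simp
  show ?thesis
    by (rule tendsto_sandwich[OF _ _ tendsto_const lim]; rule always_eventually; use lower upper in blast)
qed

text \<open>
  With \<open>r k = \<gamma> (u (Suc k) - u k)\<close>, monotonicity of the subdifferential of \<open>f\<close> reads
  \<open>(norm (r k))\<^sup>2 \<le> - (r k \<bullet> \<delta> k)\<close>. By itself this only places \<open>r k\<close> in the ball with diameter from \<open>0\<close> to
  \<open>- \<delta> k\<close>; but \<open>\<delta> k\<close> is close to \<open>\<gamma> w\<close>, and \<open>r k \<bullet> w\<close> tends to \<open>0\<close> since \<open>u k \<bullet> w\<close> converges.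
\<close>

lemma u_diff_tendsto: "(\<lambda>k. u (Suc k) - u k) \<longlonglongrightarrow> 0"
proof -
  define r where "r k = \<gamma> *\<^sub>R (u (Suc k) - u k)" for k
  have xh_step: "xh (Suc k) - xh k = - \<delta> k - r k" for k
    by (simp add: r_def z_eq[of k] z_eq[of "Suc k"] \<delta>_def algebra_simps)
  have r_le: "(norm (r k))\<^sup>2 \<le> - (r k \<bullet> \<delta> k)" for k
  proof -
    have "0 \<le> (u (Suc k) - u k) \<bullet> (- \<delta> k - r k)"
      using u_monotone[of "Suc k" k] by (simp only: xh_step)
    then have "0 \<le> \<gamma> * ((u (Suc k) - u k) \<bullet> (- \<delta> k - r k))"
      using \<gamma> by simp
    also have "\<dots> = r k \<bullet> (- \<delta> k - r k)"
      unfolding r_def[of k] inner_scaleR_left ..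
    finally show ?thesis by (simp add: power2_norm_eq_inner inner_diff_right)
  qed
  have r_bdd: "norm (r k) \<le> norm (\<delta> 0)" for k
  proof -
    have "norm (r k) * norm (r k) \<le> norm (r k) * norm (\<delta> k)"
      using r_le[of k] Cauchy_Schwarz_ineq2[of "r k" "\<delta> k"] by (simp add: power2_eq_square)
    then have "norm (r k) \<le> norm (\<delta> k)" by (cases "r k = 0") auto
    then show ?thesis using \<delta>_bounded[of k] by simp
  qed
  have rw: "(\<lambda>k. r k \<bullet> (\<gamma> *\<^sub>R w)) \<longlonglongrightarrow> 0"
  proof -
    have "(\<lambda>k. \<gamma> * \<gamma> * (u (Suc k) \<bullet> w - u k \<bullet> w)) \<longlonglongrightarrow> \<gamma> * \<gamma> * (- s - - s)"
      by (intro tendsto_intros u_inner_tendsto LIMSEQ_Suc[OF u_inner_tendsto])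
    then show ?thesis by (simp add: r_def inner_diff_left algebra_simps)
  qed
  have "(\<lambda>k. norm (\<delta> 0) * norm (\<delta> k - \<gamma> *\<^sub>R w) - r k \<bullet> (\<gamma> *\<^sub>R w)) \<longlonglongrightarrow> norm (\<delta> 0) * norm (\<gamma> *\<^sub>R w - \<gamma> *\<^sub>R w) - 0"
    by (intro tendsto_intros \<delta>_tendsto rw)
  then have "(\<lambda>k. norm (\<delta> 0) * norm (\<delta> k - \<gamma> *\<^sub>R w) - r k \<bullet> (\<gamma> *\<^sub>R w)) \<longlonglongrightarrow> 0"
    by simp
  then have "(\<lambda>k. (norm (r k))\<^sup>2) \<longlonglongrightarrow> 0"
  proof (rule Lim_null_comparison[rotated], intro always_eventually allI)
    fix k
    have "- (r k \<bullet> \<delta> k) = - (r k \<bullet> (\<delta> k - \<gamma> *\<^sub>R w)) - r k \<bullet> (\<gamma> *\<^sub>R w)"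
      by (simp add: inner_diff_right)
    moreover have "- (r k \<bullet> (\<delta> k - \<gamma> *\<^sub>R w)) \<le> norm (\<delta> 0) * norm (\<delta> k - \<gamma> *\<^sub>R w)"
      using Cauchy_Schwarz_ineq2[of "r k" "\<delta> k - \<gamma> *\<^sub>R w"]
        mult_right_mono[OF r_bdd[of k] norm_ge_zero[of "\<delta> k - \<gamma> *\<^sub>R w"]] by linarith
    ultimately show "norm ((norm (r k))\<^sup>2) \<le> norm (\<delta> 0) * norm (\<delta> k - \<gamma> *\<^sub>R w) - r k \<bullet> (\<gamma> *\<^sub>R w)"
      using r_le[of k] by simp
  qed
  then have "(\<lambda>k. norm (r k)) \<longlonglongrightarrow> 0"
    using tendsto_real_sqrt[of "\<lambda>k. (norm (r k))\<^sup>2" 0] by simp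
  then have "r \<longlonglongrightarrow> 0" by (rule tendsto_norm_zero_cancel)
  then have "(\<lambda>k. r k /\<^sub>R \<gamma>) \<longlonglongrightarrow> 0 /\<^sub>R \<gamma>" by (intro tendsto_intros)
  then show ?thesis using \<gamma> by (simp add: r_def)
qed

lemma infdist_xh_tendsto: "(\<lambda>k. infdist (xh k) (eff_dom g)) \<longlonglongrightarrow> 0"
proof -
  have "(\<lambda>k. norm (\<gamma> *\<^sub>R (u (Suc k) - u k))) \<longlonglongrightarrow> norm (\<gamma> *\<^sub>R (0::'a))"
    by (intro tendsto_intros u_diff_tendsto)
  then have "(\<lambda>k. norm (\<gamma> *\<^sub>R (u (Suc k) - u k))) \<longlonglongrightarrow> 0" by simp
  then have "(\<lambda>k. infdist (xh (Suc k)) (eff_dom g)) \<longlonglongrightarrow> 0"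
  proof (rule Lim_null_comparison[rotated], intro always_eventually allI)
    fix k
    have "infdist (xh (Suc k)) (eff_dom g) \<le> dist (xh (Suc k)) (x (Suc k))"
      by (rule infdist_le[OF x_dom])
    also have "x (Suc k) - xh (Suc k) = \<gamma> *\<^sub>R (u (Suc k) - u k)"
      using z_eq[of "Suc k"] z_Suc_eq[of k] x_eq[of k] by (simp add: algebra_simps)
    then have "dist (xh (Suc k)) (x (Suc k)) = norm (\<gamma> *\<^sub>R (u (Suc k) - u k))"
      by (simp add: dist_norm norm_minus_commute[of "xh (Suc k)" "x (Suc k)"])
    finally show "norm (infdist (xh (Suc k)) (eff_dom g)) \<le> norm (\<gamma> *\<^sub>R (u (Suc k) - u k))"
      by (simp add: infdist_nonneg)
  qed
  then show ?thesis by (rule LIMSEQ_imp_Suc)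
qed

end

section \<open>Divergence under a primal improving direction\<close>

theorem theorem9:
  fixes f g :: "real ^ 'n \<Rightarrow> ereal"
    and \<gamma> :: real
    and z0 :: "real ^ 'n"
    and xh x z :: "nat \<Rightarrow> real ^ 'n"
  assumes "closed_proper_convex f"
    and "closed_proper_convex g"
    and "\<gamma> > 0"
    and "drs_iterates f g \<gamma> z0 xh x z"
    and "dual_value f g = -\<infinity>"
    and "primal_value f g = -\<infinity>"
    and "primal_feasible f g"
    and "\<exists>d. primal_improving_direction f g d"
  shows "dual_strongly_infeasible f g \<and>
    (\<exists>d. primal_improving_direction f g d \<and>
         (\<lambda>k. x (Suc k) - xh k) \<longlonglongrightarrow> \<gamma> *\<^sub>R d) \<and>
    (\<lambda>k. f (xh k) + g (x (Suc k))) \<longlonglongrightarrow> -\<infinity> \<and>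
    \<not> convergent (\<lambda>k. (xh k, x (Suc k))) \<and>
    (\<lambda>k. infdist (xh k) (eff_dom g)) \<longlonglongrightarrow> 0 \<and>
    (\<lambda>k. infdist (x (Suc k)) (eff_dom f)) \<longlonglongrightarrow> 0"
proof -
  note f = assms(1) and g = assms(2)
  have inf: "dual_strongly_infeasible f g"
    using improving_direction_imp_dual_strongly_infeasible[OF f g] assms(8) by blast
  obtain w s t where w: "w \<noteq> 0" "w \<in> closure (eff_dom (conjugate_fun f) + eff_dom (conjugate_fun g))"
    and s: "\<And>a. a \<in> eff_dom (conjugate_fun f) \<Longrightarrow> a \<bullet> (- w) \<le> s"
    and t: "\<And>b. b \<in> eff_dom (conjugate_fun g) \<Longrightarrow> b \<bullet> (- w) \<le> t"
    and st: "s + t = - (norm w)\<^sup>2"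
    using min_norm_direction[OF f g inf] by metis
  obtain p where p: "p \<in> eff_dom f" "p \<in> eff_dom g"
    using assms(7) by (auto simp: primal_feasible_def)
  interpret douglas_rachford_min_norm f g \<gamma> z0 xh x z w p s t
    by unfold_locales (fact f g assms(3,4) w s t st p)+
  have "0 < (norm w)\<^sup>2" using w(1) by simp
  then have "s + t < 0" using st by linarith
  then have "primal_improving_direction f g (- w)"
    by (rule primal_improving_directionI[OF f g s t, rotated -1])
  moreover have "(\<lambda>k. x (Suc k) - xh k) \<longlonglongrightarrow> \<gamma> *\<^sub>R (- w)"
    using tendsto_minus[OF \<delta>_tendsto] by (simp flip: xh_minus_x)
  ultimately show ?thesis
    using inf value_tendsto_MInf[OF w(1)] not_convergent[OF w(1)] infdist_xh_tendsto infdist_x_tendsto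
    by blast
qed

end
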